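(* Let $a,b,\tilde a,\tilde b\in\mathbb{R}$ with $b>0$ and $\tilde b>-1$, and let $\alpha,\beta>0$ with $\alpha+\beta=1$. Let $\mathbb{X},\mathbb{Y}\in\mathcal{A}$ be self-adjoint and $c$-free with $\varphi(\mathbb{X}+\mathbb{Y})=a$, $\varphi((\mathbb{X}+\mathbb{Y})^2)=b+a^2$, and $\beta R_k(\mathbb{X})=\alpha R_k(\mathbb{Y})$ for all integers $k\ge1$. Let $\mathbb{S}=\mathbb{X}+\mathbb{Y}$, and let $\mu$, $\nu$ be the $\varphi$-law and the $\psi$-law of $\mathbb{S}$. Then the following statements are equivalent: 1. for all integers $n\ge0$, $$\varphi\big((\beta\mathbb{X}-\alpha\mathbb{Y})^2\mathbb{S}^n\big)=\frac{\alpha\beta}{\tilde b+1}\,\varphi\big((\tilde b\,\mathbb{S}^2+(\tilde a-a\tilde b)\mathbb{S}+(b-a\tilde a)\mathbb{I})\mathbb{S}^n\big);$$ 2. $$M_\mu(z)=\frac{(\tilde b+z\tilde a)M_\nu(z)-\tilde b-1}{M_\nu(z)\big[(b-a\tilde a)z^2+z(\tilde a-a\tilde b)+\tilde b\big]-(\tilde b+1)(1-az)};$$ 3. $$C_{\parallel}(z)=\frac{M_\nu(z)z^2b}{-M_\nu(z)(\tilde b+z\tilde a)+\tilde b+1},$$ where $C_{\parallel}$ is the function associated with $\mathbb{S}$.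
   Context: $\mathcal{A}$ is a unital $*$-algebra (unit $\mathbb{I}$) with two states (positive normalized linear functionals) $\varphi,\psi:\mathcal{A}\to\mathbb{C}$; $\psi$ is tracial, $\varphi$ need not be. Each self-adjoint element $\mathbb{Z}\in\mathcal{A}$ under consideration has a $\varphi$-law $\mu$ and a $\psi$-law $\nu$, compactly supported probability measures on $\mathbb{R}$ with $\varphi(\mathbb{Z}^n)=\int x^n\mu(dx)$, $\psi(\mathbb{Z}^n)=\int x^n\nu(dx)$. $NC(n)$ is the set of non-crossing partitions of $\{1,\dots,n\}$. A block $V$ of $\pi\in NC(n)$ is inner if there are $p,q\notin V$ lying in one common other block of $\pi$ with $p<x<q$ for all $x\in V$; otherwise it is outer. $Inn(\pi)$, $Out(\pi)$ are the sets of inner and outer blocks. The free cumulants $r_k$ and the two-state free cumulants $R_k$ are the multilinear maps $\mathcal{A}^k\to\mathbb{C}$ determined recursively by $$\psi(\mathbb{X}_1\cdots\mathbb{X}_n)=\sum_{\pi\in NC(n)}\prod_{B\in\pi}r_{|B|}(\mathbb{X}_i:i\in B),$$ $$\varphi(\mathbb{X}_1\cdots\mathbb{X}_n)=\sum_{\pi\in NC(n)}\prod_{B\in Out(\pi)}R_{|B|}(\mathbb{X}_i:i\in B)\prod_{B\in Inn(\pi)}r_{|B|}(\mathbb{X}_i:i\in B).$$ Write $R_k(\mathbb{Z})=R_k(\mathbb{Z},\dots,\mathbb{Z})$. Subalgebras $\mathcal{A}_1,\mathcal{A}_2,\dots$ are $c$-free if for all $\mathbb{X}_1,\dots,\mathbb{X}_n\in\bigcup_j\mathcal{A}_j$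 one has $r_n(\mathbb{X}_1,\dots,\mathbb{X}_n)=0$ and $R_n(\mathbb{X}_1,\dots,\mathbb{X}_n)=0$ except if all $\mathbb{X}_j$ come from the same subalgebra; elements $\mathbb{X},\mathbb{Y}$ are $c$-free if the subalgebras they generate are. $M_\mu(z)=\sum_{i\ge0}z^i\varphi(\mathbb{S}^i)$, $M_\nu(z)=\sum_{i\ge0}z^i\psi(\mathbb{S}^i)$. For a self-adjoint $\mathbb{Z}$ and $n\ge2$, $$\varphi_{\parallel}(\mathbb{Z}^n)=\sum_{k=2}^n\ \sum_{1=s_1<s_2<\dots<s_k=n}R_k(\mathbb{Z})\prod_{r=1}^{k-1}\psi(\mathbb{Z}^{s_{r+1}-1-s_r})$$ (with $\psi(\mathbb{Z}^0)=1$), and $C_{\parallel}(z)=\sum_{n=0}^\infty\varphi_{\parallel}(\mathbb{Z}^{n+2})z^{n+2}$. Identities of series are understood for $z\in\mathbb{C}$ with $|z|$ sufficiently small (equivalently, as formal power series). *)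

theory Defs
  imports
    "HOL-Probability.Probability"
    "HOL-Computational_Algebra.Formal_Power_Series"
    "HOL-Library.Disjoint_Sets"
    "HOL-Library.Nonpos_Ints"
begin

section \<open>Unital $*$-algebras over the complex numbers and states\<close>

class complex_star_algebra = ring_1 +
  fixes scaleC :: "complex \<Rightarrow> 'a \<Rightarrow> 'a"  (infixr "*\<^sub>C" 75)
    and star :: "'a \<Rightarrow> 'a"
  assumes scaleC_add_right: "c *\<^sub>C (x + y) = c *\<^sub>C x + c *\<^sub>C y"
    and scaleC_add_left: "(c + d) *\<^sub>C x = c *\<^sub>C x + d *\<^sub>C x"
    and scaleC_scaleC: "c *\<^sub>C (d *\<^sub>C x) = (c * d) *\<^sub>C x"
    and scaleC_one: "1 *\<^sub>C x = x"
    and mult_scaleC_left: "(c *\<^sub>C x) * y = c *\<^sub>C (x * y)"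
    and mult_scaleC_right: "x * (c *\<^sub>C y) = c *\<^sub>C (x * y)"
    and star_star: "star (star x) = x"
    and star_add: "star (x + y) = star x + star y"
    and star_mult: "star (x * y) = star y * star x"
    and star_scaleC: "star (c *\<^sub>C x) = cnj c *\<^sub>C star x"

definition self_adjoint :: "'a::complex_star_algebra \<Rightarrow> bool" where
  "self_adjoint x \<longleftrightarrow> star x = x"

definition state :: "('a::complex_star_algebra \<Rightarrow> complex) \<Rightarrow> bool" where
  "state \<phi> \<longleftrightarrow> Vector_Spaces.linear (*\<^sub>C) (*) \<phi>
      \<and> (\<forall>x. \<phi> (star x * x) \<in> \<real>\<^sub>\<ge>\<^sub>0) \<and> \<phi> 1 = 1"

definition tracial :: "('a::complex_star_algebra \<Rightarrow> complex) \<Rightarrow> bool" where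
  "tracial \<psi> \<longleftrightarrow> (\<forall>x y. \<psi> (x * y) = \<psi> (y * x))"

definition has_law :: "('a::complex_star_algebra \<Rightarrow> complex) \<Rightarrow> 'a \<Rightarrow> real measure \<Rightarrow> bool" where
  "has_law \<phi> Z \<mu> \<longleftrightarrow> real_distribution \<mu>
      \<and> (\<exists>K. compact K \<and> measure \<mu> K = 1)
      \<and> (\<forall>n. \<phi> (Z ^ n) = complex_of_real (\<integral>x. x ^ n \<partial>\<mu>))"


section \<open>Non-crossing partitions\<close>

text \<open>Positions are numbered from \<open>0\<close>, to match the indexing of lists: the
  ground set is \<open>{0, \<dots>, n - 1}\<close> instead of \<open>{1, \<dots>, n}\<close>.\<close>

definition NC :: "nat \<Rightarrow> nat set set set" where
  "NC n = {\<pi>. partition_on {..<n} \<pi> \<and>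
     (\<forall>V\<in>\<pi>. \<forall>W\<in>\<pi>. V \<noteq> W \<longrightarrow>
        \<not> (\<exists>i\<in>V. \<exists>j\<in>W. \<exists>k\<in>V. \<exists>l\<in>W. i < j \<and> j < k \<and> k < l))}"

definition Inn :: "nat set set \<Rightarrow> nat set set" where
  "Inn \<pi> = {V\<in>\<pi>. \<exists>W\<in>\<pi>. W \<noteq> V \<and> (\<exists>p\<in>W. \<exists>q\<in>W. \<forall>x\<in>V. p < x \<and> x < q)}"

definition Out :: "nat set set \<Rightarrow> nat set set" where
  "Out \<pi> = \<pi> - Inn \<pi>"

lemma finite_NC: "finite (NC n)"
proof (rule finite_subset)
  show "NC n \<subseteq> Pow (Pow {..<n})"
    by (auto simp: NC_def partition_on_def)
qed simp

lemma finite_block_set: "\<pi> \<in> NC n \<Longrightarrow> finite \<pi>"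
  by (auto simp: NC_def intro: finite_elements)

lemma full_in_NC: "0 < n \<Longrightarrow> {{..<n}} \<in> NC n"
  by (auto simp: NC_def partition_on_def disjoint_def)

lemma Inn_full: "Inn {B} = {}"
  by (auto simp: Inn_def)

lemma length_nths_block:
  assumes "\<pi> \<in> NC (length xs)" "\<pi> \<noteq> {{..<length xs}}" "B \<in> \<pi>"
  shows "length (nths xs B) < length xs"
proof -
  have part: "partition_on {..<length xs} \<pi>"
    using assms(1) by (simp add: NC_def)
  have sub: "B \<subseteq> {..<length xs}"
    using part assms(3) by (auto simp: partition_on_def)
  have "B \<noteq> {..<length xs}"
  proof
    assume B: "B = {..<length xs}"
    have "C = B" if "C \<in> \<pi>" for C
    proof (rule ccontr)
      assume "C \<noteq> B"
      then have "C \<inter> B = {}"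
        using part that assms(3) by (auto simp: partition_on_def disjoint_def)
      moreover have "C \<subseteq> B" "C \<noteq> {}"
        using part that B by (auto simp: partition_on_def)
      ultimately show False by auto
    qed
    then have "\<pi> = {B}" using assms(3) by blast
    then show False using assms(2) B by simp
  qed
  then have "B \<subset> {..<length xs}" using sub by auto
  then have "card B < length xs"
    by (metis card_lessThan finite_lessThan psubset_card_mono)
  moreover have "{i. i < length xs \<and> i \<in> B} = B" using sub by auto
  ultimately show ?thesis by (simp add: length_nths)
qed


section \<open>Free and two-state free cumulants\<close>

text \<open>The term of the one-block partition is the cumulant of the whole list, so solving
  the moment-cumulant formula for it gives the recursion. \<open>nths xs B\<close> is the
  list of the entries of \<open>xs\<close> at the positions in \<open>B\<close>, in increasing order.
  The cumulants of the empty list carry no meaning.\<close>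

function free_cumulant :: "('a::monoid_mult \<Rightarrow> complex) \<Rightarrow> 'a list \<Rightarrow> complex" where
  "free_cumulant \<psi> xs = \<psi> (prod_list xs)
     - (\<Sum>\<pi> \<in> NC (length xs) - {{{..<length xs}}}. \<Prod>B\<in>\<pi>. free_cumulant \<psi> (nths xs B))"
  by pat_completeness auto
termination
  by (relation "Wellfounded.measure (\<lambda>(\<psi>, xs). length xs)") (auto intro!: length_nths_block)

declare free_cumulant.simps [simp del]

function two_state_cumulant ::
  "('a::monoid_mult \<Rightarrow> complex) \<Rightarrow> ('a \<Rightarrow> complex) \<Rightarrow> 'a list \<Rightarrow> complex" where
  "two_state_cumulant \<phi> \<psi> xs = \<phi> (prod_list xs)
     - (\<Sum>\<pi> \<in> NC (length xs) - {{{..<length xs}}}.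
          (\<Prod>B\<in>Out \<pi>. two_state_cumulant \<phi> \<psi> (nths xs B)) *
          (\<Prod>B\<in>Inn \<pi>. free_cumulant \<psi> (nths xs B)))"
  by pat_completeness auto
termination
  by (relation "Wellfounded.measure (\<lambda>(\<phi>, \<psi>, xs). length xs)")
    (auto simp: Out_def intro!: length_nths_block)

declare two_state_cumulant.simps [simp del]

lemma moment_free_cumulant:
  assumes "xs \<noteq> []"
  shows "\<psi> (prod_list xs) = (\<Sum>\<pi> \<in> NC (length xs). \<Prod>B\<in>\<pi>. free_cumulant \<psi> (nths xs B))"
proof -
  let ?f = "\<lambda>\<pi>. \<Prod>B\<in>\<pi>. free_cumulant \<psi> (nths xs B)"
  have "sum ?f (NC (length xs)) = ?f {{..<length xs}} + sum ?f (NC (length xs) - {{{..<length xs}}})"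
    using assms by (intro sum.remove finite_NC full_in_NC) simp
  then show ?thesis
    by (simp add: nths_all free_cumulant.simps[of \<psi> xs])
qed

lemma moment_two_state_cumulant:
  assumes "xs \<noteq> []"
  shows "\<phi> (prod_list xs) = (\<Sum>\<pi> \<in> NC (length xs).
     (\<Prod>B\<in>Out \<pi>. two_state_cumulant \<phi> \<psi> (nths xs B)) *
     (\<Prod>B\<in>Inn \<pi>. free_cumulant \<psi> (nths xs B)))"
proof -
  let ?f = "\<lambda>\<pi>. (\<Prod>B\<in>Out \<pi>. two_state_cumulant \<phi> \<psi> (nths xs B)) *
     (\<Prod>B\<in>Inn \<pi>. free_cumulant \<psi> (nths xs B))"
  have "sum ?f (NC (length xs)) = ?f {{..<length xs}} + sum ?f (NC (length xs) - {{{..<length xs}}})"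
    using assms by (intro sum.remove finite_NC full_in_NC) simp
  then show ?thesis
    by (simp add: nths_all Out_def Inn_full two_state_cumulant.simps[of \<phi> \<psi> xs])
qed


section \<open>c-freeness\<close>

definition subalgebra :: "'a::complex_star_algebra set \<Rightarrow> bool" where
  "subalgebra A \<longleftrightarrow> 1 \<in> A \<and> (\<forall>x\<in>A. \<forall>y\<in>A. x + y \<in> A \<and> x * y \<in> A)
      \<and> (\<forall>c. \<forall>x\<in>A. c *\<^sub>C x \<in> A)"

text \<open>As usual for freeness, the entries of a mixed cumulant are labelled by the subalgebra
  they are taken from: it must vanish for every non-constant choice of labels \<open>js\<close>
  compatible with the entries. (Requiring only that the entries have no common
  subalgebra would make every element c-free from itself.)\<close>

definition c_free ::
  "('a::complex_star_algebra \<Rightarrow> complex) \<Rightarrow> ('a \<Rightarrow> complex) \<Rightarrow> 'i set \<Rightarrow> ('i \<Rightarrow> 'a set) \<Rightarrow> bool" where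
  "c_free \<phi> \<psi> I \<A> \<longleftrightarrow> (\<forall>j\<in>I. subalgebra (\<A> j)) \<and>
     (\<forall>xs js. list_all2 (\<lambda>x j. j \<in> I \<and> x \<in> \<A> j) xs js \<and> (\<exists>i\<in>set js. \<exists>j\<in>set js. i \<noteq> j) \<longrightarrow>
        free_cumulant \<psi> xs = 0 \<and> two_state_cumulant \<phi> \<psi> xs = 0)"

definition c_free_elements ::
  "('a::complex_star_algebra \<Rightarrow> complex) \<Rightarrow> ('a \<Rightarrow> complex) \<Rightarrow> 'a \<Rightarrow> 'a \<Rightarrow> bool" where
  "c_free_elements \<phi> \<psi> X Y \<longleftrightarrow>
     c_free \<phi> \<psi> {1, 2 :: nat} (\<lambda>j. subalgebra hull {if j = 1 then X else Y})"


section \<open>Generating series\<close>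

text \<open>Identities between functions of small \<open>z\<close> are stated as identities of
  formal power series, with \<open>fps_X\<close> in the role of \<open>z\<close>.\<close>

definition moment_series :: "('a::complex_star_algebra \<Rightarrow> complex) \<Rightarrow> 'a \<Rightarrow> complex fps" where
  "moment_series \<phi> Z = Abs_fps (\<lambda>i. \<phi> (Z ^ i))"

text \<open>The inner sum ranges over the lists \<open>s = [s\<^sub>1, \<dots>, s\<^sub>k]\<close>
  with \<open>1 = s\<^sub>1 < \<dots> < s\<^sub>k = n\<close>; the product runs
  over \<open>r = 1, \<dots>, k - 1\<close> with list positions shifted down by one.\<close>

definition phi_par ::
  "('a::complex_star_algebra \<Rightarrow> complex) \<Rightarrow> ('a \<Rightarrow> complex) \<Rightarrow> 'a \<Rightarrow> nat \<Rightarrow> complex" where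
  "phi_par \<phi> \<psi> Z n = (\<Sum>k = 2..n.
     \<Sum>s \<in> {s. length s = k \<and> sorted_wrt (<) s \<and> hd s = 1 \<and> last s = n}.
       two_state_cumulant \<phi> \<psi> (replicate k Z) *
       (\<Prod>r<k - 1. \<psi> (Z ^ (s ! Suc r - 1 - s ! r))))"

definition C_par ::
  "('a::complex_star_algebra \<Rightarrow> complex) \<Rightarrow> ('a \<Rightarrow> complex) \<Rightarrow> 'a \<Rightarrow> complex fps" where
  "C_par \<phi> \<psi> Z = fps_X ^ 2 * Abs_fps (\<lambda>n. phi_par \<phi> \<psi> Z (n + 2))"

abbreviation fps_real :: "real \<Rightarrow> complex fps" where
  "fps_real c \<equiv> fps_const (complex_of_real c)"

end

(* Idea. Put V = beta X - alpha Y. By c-freeness and beta R_k(X) = alpha R_k(Y), the cumulant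
   R_k(V, S, ..., S) vanishes while R_k(V, V, S, ..., S) = alpha beta R_k(S). Hence in the
   moment-cumulant expansion of phi(V^2 S^n) only the partitions joining the first two points
   survive. Splitting off the block of the first point gives, for T(z) = sum over n of
   z^(n+2) phi(V^2 S^n) / (alpha beta),

     M_mu = 1 + a z M_mu + C_par M_mu    and    T M_nu = C_par M_mu.

   Statement 1 is linear in T and M_mu; multiplied by M_nu it becomes statement 2, and
   statement 3 is statement 2 with M_mu = 1 / (1 - a z - C_par) inserted. *)

theory Submission
  imports Defs
begin

section \<open>Weighted sums over non-crossing partitions\<close>

text \<open>The identity T M_nu = C_par M_mu compares partitions that differ in one gap. Between two
  consecutive points of the first block lies a partition all of whose blocks are inner, so a gap
  contributes M_nu; what follows the last point contributes M_mu. In T the first two points are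
  neighbours, so exactly one factor M_nu is missing, and multiplying by M_nu restores it. The proof
  removes the first block one point at a time, and an offset \<open>k\<close> remembers how many of
  its points are gone. This produces series F_k with F_k = z R_(k+1) M_mu + z M_nu F_(k+1), a
  recursion that climbs in \<open>k\<close> and has no base case. The chain sums behind C_par obey
  the same recursion without M_mu, and the factor z makes solutions unique, so F_k is a chain series
  times M_mu. The case k = 0 is the first identity, and k = 1 leads to the second. The relation
  between \<open>X\<close> and \<open>Y\<close> concerns the R_k only. A partition whose second
  \<open>V\<close> lies outside the first block already vanishes through the factor of the first
  block, so free cumulants with an entry \<open>V\<close> never have to be evaluated.\<close>

definition crossing :: "nat set \<Rightarrow> nat set \<Rightarrow> bool" where
  "crossing V W \<longleftrightarrow> (\<exists>i\<in>V. \<exists>j\<in>W. \<exists>k\<in>V. \<exists>l\<in>W. i < j \<and> j < k \<and> k < l)"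

text \<open>The ground set is an arbitrary set of naturals, so that the two pieces
  \<open>A \<inter> {..<j}\<close> and \<open>A \<inter> {j..}\<close> of a cut partition belong to
  the same family without renumbering.\<close>

definition nc_partitions :: "nat set \<Rightarrow> nat set set set" where
  "nc_partitions A = {\<pi>. partition_on A \<pi> \<and> (\<forall>V\<in>\<pi>. \<forall>W\<in>\<pi>. V \<noteq> W \<longrightarrow> \<not> crossing V W)}"

text \<open>The block of the least element has its own weight \<open>h\<close>, which lets a recursion remember
  the part of that block that has already been split off.\<close>

definition nc_sum :: "(nat set \<Rightarrow> 'b::comm_ring_1) \<Rightarrow> (nat set \<Rightarrow> 'b) \<Rightarrow> (nat set \<Rightarrow> 'b) \<Rightarrow> nat set \<Rightarrow> 'b" where
  "nc_sum h f g A = (\<Sum>\<pi>\<in>nc_partitions A. \<Prod>B\<in>\<pi>.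
     if B \<in> Inn \<pi> then g B else if Min A \<in> B then h B else f B)"

lemma NC_eq: "NC n = nc_partitions {..<n}"
  by (simp add: NC_def nc_partitions_def crossing_def)

lemma nc_partitions_subset: "\<pi> \<in> nc_partitions A \<Longrightarrow> B \<in> \<pi> \<Longrightarrow> B \<subseteq> A"
  by (auto simp: nc_partitions_def partition_on_def)

lemma nc_partitions_nonempty: "\<pi> \<in> nc_partitions A \<Longrightarrow> B \<in> \<pi> \<Longrightarrow> B \<noteq> {}"
  by (auto simp: nc_partitions_def partition_on_def)

lemma nc_partitions_Union: "\<pi> \<in> nc_partitions A \<Longrightarrow> \<Union>\<pi> = A"
  by (auto simp: nc_partitions_def partition_on_def)

lemma nc_partitions_eq:
  "\<pi> \<in> nc_partitions A \<Longrightarrow> B \<in> \<pi> \<Longrightarrow> C \<in> \<pi> \<Longrightarrow> x \<in> B \<Longrightarrow> x \<in> C \<Longrightarrow> B = C"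
  by (auto simp: nc_partitions_def partition_on_def disjoint_def)

lemma nc_partitions_not_crossing:
  "\<pi> \<in> nc_partitions A \<Longrightarrow> B \<in> \<pi> \<Longrightarrow> C \<in> \<pi> \<Longrightarrow> B \<noteq> C \<Longrightarrow> \<not> crossing B C"
  by (auto simp: nc_partitions_def)

lemma nc_partitionsI:
  assumes "\<And>B. B \<in> \<pi> \<Longrightarrow> B \<noteq> {}" "\<Union>\<pi> = A"
    and "\<And>B C x. B \<in> \<pi> \<Longrightarrow> C \<in> \<pi> \<Longrightarrow> x \<in> B \<Longrightarrow> x \<in> C \<Longrightarrow> B = C"
    and "\<And>B C. B \<in> \<pi> \<Longrightarrow> C \<in> \<pi> \<Longrightarrow> B \<noteq> C \<Longrightarrow> \<not> crossing B C"
  shows "\<pi> \<in> nc_partitions A"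
  using assms unfolding nc_partitions_def partition_on_def disjoint_def by blast

lemma finite_nc_partitions: "finite A \<Longrightarrow> finite (nc_partitions A)"
  by (rule finite_subset[of _ "Pow (Pow A)"]) (auto simp: nc_partitions_def partition_on_def)

lemma finite_nc_partition: "finite A \<Longrightarrow> \<pi> \<in> nc_partitions A \<Longrightarrow> finite \<pi>"
  by (auto simp: nc_partitions_def intro: finite_elements)

lemma nc_partitions_empty: "nc_partitions {} = {{}}"
  by (auto simp: nc_partitions_def partition_on_def)

lemma nc_sum_empty [simp]: "nc_sum h f g {} = 1"
  by (simp add: nc_sum_def nc_partitions_empty)

lemma Inn_subset: "Inn \<pi> \<subseteq> \<pi>"
  by (auto simp: Inn_def)

lemma nc_sum_all_eq: "nc_sum g g g A = (\<Sum>\<pi>\<in>nc_partitions A. \<Prod>B\<in>\<pi>. g B)"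
  by (simp add: nc_sum_def cong: if_cong)

text \<open>An inner block lies strictly above a point of another block. Hence the first two cases
  of the weight in \<open>nc_sum\<close> exclude each other.\<close>

lemma Inn_not_Min:
  assumes "\<pi> \<in> nc_partitions A" "finite A" "B \<in> Inn \<pi>"
  shows "Min A \<notin> B"
proof
  assume "Min A \<in> B"
  with assms(3) obtain W p where "W \<in> \<pi>" "p \<in> W" "p < Min A"
    by (auto simp: Inn_def)
  then show False
    using nc_partitions_subset[OF assms(1)] assms(2) by (metis Min_le leD subsetD)
qed

text \<open>Each weight is compared only on the blocks on which it can be evaluated. In
  \<open>moment_first_two_linked\<close> this confines \<open>f\<close> and \<open>g\<close> to
  blocks without an entry \<open>V\<close>.\<close>

lemma nc_sum_cong:
  assumes "finite A"
    and "\<And>B. B \<subseteq> A \<Longrightarrow> B \<noteq> {} \<Longrightarrow> Min A \<in> B \<Longrightarrow> h B = h' B"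
    and "\<And>B. B \<subseteq> A \<Longrightarrow> B \<noteq> {} \<Longrightarrow> Min A \<notin> B \<Longrightarrow> f B = f' B"
    and "\<And>B. B \<subseteq> A \<Longrightarrow> B \<noteq> {} \<Longrightarrow> Min A \<notin> B \<Longrightarrow> g B = g' B"
  shows "nc_sum h f g A = nc_sum h' f' g' A"
  unfolding nc_sum_def
proof (intro sum.cong prod.cong refl)
  fix \<pi> B assume *: "\<pi> \<in> nc_partitions A" "B \<in> \<pi>"
  then have "B \<subseteq> A" "B \<noteq> {}"
    using nc_partitions_subset nc_partitions_nonempty by blast+
  then show "(if B \<in> Inn \<pi> then g B else if Min A \<in> B then h B else f B) =
    (if B \<in> Inn \<pi> then g' B else if Min A \<in> B then h' B else f' B)"
    using assms Inn_not_Min[OF *(1) assms(1)] by auto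
qed

text \<open>Some block contains the least element, and it is outer, so every product has a factor
  \<open>h\<close>.\<close>

lemma nc_sum_zero:
  assumes "finite A" "A \<noteq> {}" "\<And>B. B \<subseteq> A \<Longrightarrow> Min A \<in> B \<Longrightarrow> h B = 0"
  shows "nc_sum h f g A = 0"
  unfolding nc_sum_def
proof (intro sum.neutral ballI)
  fix \<pi> assume \<pi>: "\<pi> \<in> nc_partitions A"
  then obtain B where B: "B \<in> \<pi>" "Min A \<in> B"
    using nc_partitions_Union[OF \<pi>] Min_in[OF assms(1,2)] by blast
  then have "B \<notin> Inn \<pi>" "h B = 0"
    using Inn_not_Min[OF \<pi> assms(1)] assms(3) nc_partitions_subset[OF \<pi>] by blast+
  then have "\<exists>B\<in>\<pi>. (if B \<in> Inn \<pi> then g B else if Min A \<in> B then h B else f B) = 0"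
    using B by auto
  then show "(\<Prod>B\<in>\<pi>. if B \<in> Inn \<pi> then g B else if Min A \<in> B then h B else f B) = 0"
    by (intro prod_zero finite_nc_partition[OF assms(1) \<pi>])
qed

text \<open>Exactly one block contains the least element, so the scalar comes out once. For empty
  \<open>A\<close> there would be no such factor: the sum is then 1 for every
  \<open>h\<close>.\<close>

lemma nc_sum_mult:
  assumes "finite A" "A \<noteq> {}"
  shows "nc_sum (\<lambda>B. c * h B) f g A = c * nc_sum h f g A"
  unfolding nc_sum_def sum_distrib_left
proof (intro sum.cong refl)
  fix \<pi> assume \<pi>: "\<pi> \<in> nc_partitions A"
  then obtain B where B: "B \<in> \<pi>" "Min A \<in> B"
    using nc_partitions_Union[OF \<pi>] Min_in[OF assms(1,2)] by blast
  have fin: "finite \<pi>" by (rule finite_nc_partition[OF assms(1) \<pi>])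
  have nI: "B \<notin> Inn \<pi>" using Inn_not_Min[OF \<pi> assms(1)] B by blast
  have eq: "(\<Prod>B\<in>\<pi> - {B}. if B \<in> Inn \<pi> then g B else if Min A \<in> B then c * h B else f B)
     = (\<Prod>B\<in>\<pi> - {B}. if B \<in> Inn \<pi> then g B else if Min A \<in> B then h B else f B)"
    using B nc_partitions_eq[OF \<pi>] by (intro prod.cong) auto
  show "(\<Prod>B\<in>\<pi>. if B \<in> Inn \<pi> then g B else if Min A \<in> B then c * h B else f B) =
    c * (\<Prod>B\<in>\<pi>. if B \<in> Inn \<pi> then g B else if Min A \<in> B then h B else f B)"
    unfolding prod.remove[OF fin B(1)] eq using nI B by (simp add: mult.assoc)
qed

lemma prod_Out_Inn:
  assumes "finite \<pi>"
  shows "(\<Prod>B\<in>Out \<pi>. f B) * (\<Prod>B\<in>Inn \<pi>. g B) = (\<Prod>B\<in>\<pi>. if B \<in> Inn \<pi> then g B else f B)"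
proof -
  have "(\<Prod>B\<in>\<pi>. if B \<in> Inn \<pi> then g B else f B) =
      (\<Prod>B\<in>\<pi> - Inn \<pi>. if B \<in> Inn \<pi> then g B else f B) * (\<Prod>B\<in>Inn \<pi>. if B \<in> Inn \<pi> then g B else f B)"
    by (rule prod.subset_diff[OF Inn_subset assms])
  also have "\<dots> = (\<Prod>B\<in>Out \<pi>. f B) * (\<Prod>B\<in>Inn \<pi>. g B)"
    by (simp add: Out_def)
  finally show ?thesis by simp
qed

section \<open>Partitions in which the least element is a block of its own\<close>

lemma nc_partitions_insert_singleton:
  assumes "a \<notin> A" "\<forall>x\<in>A. a < x"
  shows "{\<pi> \<in> nc_partitions (insert a A). {a} \<in> \<pi>} = insert {a} ` nc_partitions A"
proof (intro equalityI subsetI)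
  fix \<pi> assume "\<pi> \<in> {\<pi> \<in> nc_partitions (insert a A). {a} \<in> \<pi>}"
  then have \<pi>: "\<pi> \<in> nc_partitions (insert a A)" and a: "{a} \<in> \<pi>" by auto
  have na: "a \<notin> B" if "B \<in> \<pi> - {{a}}" for B
    using nc_partitions_eq[OF \<pi> a, of B a] that by auto
  have "\<pi> - {{a}} \<in> nc_partitions A"
  proof (rule nc_partitionsI)
    have "\<Union>\<pi> = insert a A" by (rule nc_partitions_Union[OF \<pi>])
    moreover have "\<Union>\<pi> = insert a (\<Union>(\<pi> - {{a}}))" using a by blast
    moreover have "a \<notin> \<Union>(\<pi> - {{a}})" using na by blast
    ultimately show "\<Union>(\<pi> - {{a}}) = A"
      using assms(1) by (metis insert_ident)
  next
    fix B assume "B \<in> \<pi> - {{a}}"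
    then show "B \<noteq> {}" using nc_partitions_nonempty[OF \<pi>, of B] by auto
  next
    fix B C x assume "B \<in> \<pi> - {{a}}" "C \<in> \<pi> - {{a}}" "x \<in> B" "x \<in> C"
    then show "B = C" using nc_partitions_eq[OF \<pi>, of B C x] by auto
  next
    fix B C assume "B \<in> \<pi> - {{a}}" "C \<in> \<pi> - {{a}}" "B \<noteq> C"
    then show "\<not> crossing B C" using nc_partitions_not_crossing[OF \<pi>, of B C] by auto
  qed
  moreover have "\<pi> = insert {a} (\<pi> - {{a}})" using a by auto
  ultimately show "\<pi> \<in> insert {a} ` nc_partitions A" by blast
next
  fix \<pi> assume "\<pi> \<in> insert {a} ` nc_partitions A"
  then obtain \<pi>' where \<pi>': "\<pi>' \<in> nc_partitions A" and eq: "\<pi> = insert {a} \<pi>'" by auto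
  have na: "a \<notin> B" if "B \<in> \<pi>'" for B
    using nc_partitions_subset[OF \<pi>' that] assms(1) by blast
  have nc: "\<not> crossing {a} C" "\<not> crossing C {a}" for C
    by (auto simp: crossing_def)
  have "\<pi> \<in> nc_partitions (insert a A)"
    unfolding eq
  proof (rule nc_partitionsI)
    show "\<Union>(insert {a} \<pi>') = insert a A" using nc_partitions_Union[OF \<pi>'] by auto
  next
    fix B assume "B \<in> insert {a} \<pi>'"
    then show "B \<noteq> {}" using nc_partitions_nonempty[OF \<pi>', of B] by auto
  next
    fix B C x assume "B \<in> insert {a} \<pi>'" "C \<in> insert {a} \<pi>'" "x \<in> B" "x \<in> C"
    then show "B = C" using nc_partitions_eq[OF \<pi>', of B C x] na by auto
  next
    fix B C assume "B \<in> insert {a} \<pi>'" "C \<in> insert {a} \<pi>'" "B \<noteq> C"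
    then show "\<not> crossing B C" using nc_partitions_not_crossing[OF \<pi>', of B C] nc by auto
  qed
  then show "\<pi> \<in> {\<pi> \<in> nc_partitions (insert a A). {a} \<in> \<pi>}" using eq by simp
qed

text \<open>Enclosing a nonempty block takes two distinct points, so \<open>{a}\<close> encloses
  nothing; being least, it is not enclosed either.\<close>

lemma Inn_insert_singleton:
  assumes \<pi>: "\<pi> \<in> nc_partitions A" and "\<forall>x\<in>A. a < x"
  shows "Inn (insert {a} \<pi>) = Inn \<pi>"
proof (intro equalityI subsetI)
  fix V assume "V \<in> Inn (insert {a} \<pi>)"
  then obtain W p q where V: "V \<in> insert {a} \<pi>" and W: "W \<in> insert {a} \<pi>" "W \<noteq> V" "p \<in> W" "q \<in> W"
    "\<forall>x\<in>V. p < x \<and> x < q" by (auto simp: Inn_def)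
  have "W = {a} \<or> W \<subseteq> A" using W(1) nc_partitions_subset[OF \<pi>, of W] by blast
  then have "a \<le> p" using W(3) assms(2) by (metis less_imp_le order_refl singletonD subsetD)
  then have "V \<noteq> {a}" using W by auto
  moreover have "V \<noteq> {}" using V nc_partitions_nonempty[OF \<pi>] by blast
  then have "p < q" using W(5) by force
  then have "W \<noteq> {a}" using W by auto
  ultimately show "V \<in> Inn \<pi>" using V W by (auto simp: Inn_def)
next
  fix V assume "V \<in> Inn \<pi>"
  then show "V \<in> Inn (insert {a} \<pi>)" by (auto simp: Inn_def)
qed

section \<open>Partitions in which the block of the least element continues\<close>

definition block_of :: "nat set set \<Rightarrow> nat \<Rightarrow> nat set" where
  "block_of \<pi> x = (THE B. B \<in> \<pi> \<and> x \<in> B)"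

lemma block_of_eq: "\<pi> \<in> nc_partitions A \<Longrightarrow> B \<in> \<pi> \<Longrightarrow> x \<in> B \<Longrightarrow> block_of \<pi> x = B"
  unfolding block_of_def by (intro the_equality) (use nc_partitions_eq in blast)+

lemma block_of_in:
  assumes "\<pi> \<in> nc_partitions A" "x \<in> A"
  shows "block_of \<pi> x \<in> \<pi>" "x \<in> block_of \<pi> x"
proof -
  obtain B where "B \<in> \<pi>" "x \<in> B" using nc_partitions_Union[OF assms(1)] assms(2) by blast
  then show "block_of \<pi> x \<in> \<pi>" "x \<in> block_of \<pi> x"
    using block_of_eq[OF assms(1)] by auto
qed

text \<open>The inverse of a cut: \<open>\<pi>\<close> fills the gap between \<open>a\<close> and
  \<open>j\<close>, \<open>\<rho>\<close> lives on the points from \<open>j\<close> on, and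
  \<open>a\<close> is attached to the block of \<open>j\<close>.\<close>

definition glue :: "nat \<Rightarrow> nat \<Rightarrow> nat set set \<Rightarrow> nat set set \<Rightarrow> nat set set" where
  "glue a j \<pi> \<rho> = insert (insert a (block_of \<rho> j)) (\<pi> \<union> (\<rho> - {block_of \<rho> j}))"

context
  fixes a j :: nat and A :: "nat set" and \<pi> \<rho> :: "nat set set" and C :: "nat set"
  assumes lt: "\<forall>x\<in>A. a < x" and j: "j \<in> A"
    and \<pi>: "\<pi> \<in> nc_partitions (A \<inter> {..<j})" and \<rho>: "\<rho> \<in> nc_partitions (A \<inter> {j..})"
    and C_def: "C = block_of \<rho> j"
begin

lemma glue_C: "C \<in> \<rho>" "j \<in> C" "C \<subseteq> A \<inter> {j..}" "a \<notin> C"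
proof -
  show C: "C \<in> \<rho>" "j \<in> C" using block_of_in[OF \<rho>, of j] j C_def by auto
  show "C \<subseteq> A \<inter> {j..}" by (rule nc_partitions_subset[OF \<rho> C(1)])
  then show "a \<notin> C" using lt by auto
qed

lemma glue_lower: "B \<in> \<pi> \<Longrightarrow> x \<in> B \<Longrightarrow> x \<in> A \<and> a < x \<and> x < j"
  using nc_partitions_subset[OF \<pi>, of B] lt by auto

lemma glue_upper: "B \<in> \<rho> \<Longrightarrow> x \<in> B \<Longrightarrow> x \<in> A \<and> a < x \<and> j \<le> x"
  using nc_partitions_subset[OF \<rho>, of B] lt by auto

lemma glue_upper_strict: "B \<in> \<rho> \<Longrightarrow> B \<noteq> C \<Longrightarrow> x \<in> B \<Longrightarrow> j < x"
  using glue_upper[of B x] nc_partitions_eq[OF \<rho>, of B C j] glue_C by (cases "x = j") auto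

lemma glue_eq: "glue a j \<pi> \<rho> = insert (insert a C) (\<pi> \<union> (\<rho> - {C}))"
  by (simp add: glue_def C_def)

lemma glue_notin: "insert a C \<notin> \<pi>" "insert a C \<notin> \<rho>" "\<pi> \<inter> \<rho> = {}"
proof -
  show "insert a C \<notin> \<pi>" "insert a C \<notin> \<rho>"
    using glue_lower[of "insert a C" a] glue_upper[of "insert a C" a] by auto
  show "\<pi> \<inter> \<rho> = {}"
  proof (rule ccontr)
    assume "\<pi> \<inter> \<rho> \<noteq> {}"
    then obtain B where B: "B \<in> \<pi>" "B \<in> \<rho>" by auto
    then obtain x where "x \<in> B" using nc_partitions_nonempty[OF \<pi>] by auto
    then show False using glue_lower[OF B(1)] glue_upper[OF B(2)] by fastforce
  qed
qed

text \<open>No point of \<open>insert a C\<close> lies strictly between \<open>a\<close> and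
  \<open>j\<close>, so a block of \<open>\<pi>\<close> sits inside a single gap of it. The other
  blocks of \<open>\<rho>\<close> lie strictly above \<open>j\<close>; in a crossing where
  \<open>a\<close> comes first, \<open>j\<close> can take its place, which gives a crossing inside
  \<open>\<rho>\<close>.\<close>

lemma glue_nc: "glue a j \<pi> \<rho> \<in> nc_partitions (insert a A)"
  unfolding glue_eq
proof (rule nc_partitionsI)
  fix B assume "B \<in> insert (insert a C) (\<pi> \<union> (\<rho> - {C}))"
  then show "B \<noteq> {}"
    using nc_partitions_nonempty[OF \<pi>, of B] nc_partitions_nonempty[OF \<rho>, of B] by auto
next
  have "\<Union>\<rho> = C \<union> \<Union>(\<rho> - {C})" using glue_C(1) by auto
  then have "\<Union>(insert (insert a C) (\<pi> \<union> (\<rho> - {C}))) = insert a (\<Union>\<pi> \<union> \<Union>\<rho>)" by auto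
  also have "\<dots> = insert a A"
    unfolding nc_partitions_Union[OF \<pi>] nc_partitions_Union[OF \<rho>] by auto
  finally show "\<Union>(insert (insert a C) (\<pi> \<union> (\<rho> - {C}))) = insert a A" .
next
  fix B D x assume BD: "B \<in> insert (insert a C) (\<pi> \<union> (\<rho> - {C}))"
    "D \<in> insert (insert a C) (\<pi> \<union> (\<rho> - {C}))" "x \<in> B" "x \<in> D"
  have 2: "V = C" if "V \<in> \<rho>" "x \<in> V" "x \<in> insert a C" for V
    using glue_upper[OF that(1,2)] that nc_partitions_eq[OF \<rho>, of V C x] glue_C(1) by auto
  have 3: "False" if "V \<in> \<pi>" "x \<in> V" "x \<in> insert a C" for V
    using glue_lower[OF that(1,2)] that(3) glue_C(3) by auto
  have 4: "False" if "V \<in> \<pi>" "x \<in> V" "W \<in> \<rho>" "x \<in> W" for V W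
    using glue_lower[OF that(1,2)] glue_upper[OF that(3,4)] by auto
  consider "B = insert a C" | "B \<in> \<pi>" | "B \<in> \<rho>" "B \<noteq> C" using BD(1) by auto
  then show "B = D"
  proof cases
    case 1
    then show ?thesis using BD(2-4) 2[of D] 3[of D] by auto
  next
    case 2
    then show ?thesis
      using BD(2-4) 3[of B] 4[of B D] nc_partitions_eq[OF \<pi>, of B D x] by auto
  next
    case 3
    then show ?thesis
      using BD(2-4) \<open>\<And>V. V \<in> \<rho> \<Longrightarrow> x \<in> V \<Longrightarrow> x \<in> insert a C \<Longrightarrow> V = C\<close>[of B]
        4[of D B] nc_partitions_eq[OF \<rho>, of B D x] by auto
  qed
next
  fix B D assume BD: "B \<in> insert (insert a C) (\<pi> \<union> (\<rho> - {C}))"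
    "D \<in> insert (insert a C) (\<pi> \<union> (\<rho> - {C}))" "B \<noteq> D"
  have C_ge: "x \<in> C \<Longrightarrow> j \<le> x \<and> a < x" for x using glue_C(3) lt by auto
  have 1: "\<not> crossing (insert a C) V" "\<not> crossing V (insert a C)" if V: "V \<in> \<pi>" for V
  proof -
    show "\<not> crossing (insert a C) V"
    proof
      assume "crossing (insert a C) V"
      then obtain i k l m where "i \<in> insert a C" "k \<in> V" "l \<in> insert a C" "m \<in> V" "i < k" "k < l" "l < m"
        by (auto simp: crossing_def)
      then show False using glue_lower[OF V, of k] glue_lower[OF V, of m] C_ge[of l] by auto
    qed
    show "\<not> crossing V (insert a C)"
    proof
      assume "crossing V (insert a C)"
      then obtain i k l m where "i \<in> V" "k \<in> insert a C" "l \<in> V" "m \<in> insert a C" "i < k" "k < l" "l < m"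
        by (auto simp: crossing_def)
      then show False using glue_lower[OF V, of i] glue_lower[OF V, of l] C_ge[of k] by auto
    qed
  qed
  have 2: "\<not> crossing (insert a C) V" "\<not> crossing V (insert a C)" if V: "V \<in> \<rho>" "V \<noteq> C" for V
  proof -
    show "\<not> crossing (insert a C) V"
    proof
      assume "crossing (insert a C) V"
      then obtain i k l m where *: "i \<in> insert a C" "k \<in> V" "l \<in> insert a C" "m \<in> V" "i < k" "k < l" "l < m"
        by (auto simp: crossing_def)
      have "l \<in> C" using * glue_upper[OF V(1), of k] by auto
      moreover have "j < k" using glue_upper_strict[OF V, of k] * by auto
      ultimately have "crossing C V"
        unfolding crossing_def using * glue_C(2) by blast
      then show False using nc_partitions_not_crossing[OF \<rho>, of C V] V glue_C(1) by auto
    qed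
    show "\<not> crossing V (insert a C)"
    proof
      assume "crossing V (insert a C)"
      then obtain i k l m where *: "i \<in> V" "k \<in> insert a C" "l \<in> V" "m \<in> insert a C" "i < k" "k < l" "l < m"
        by (auto simp: crossing_def)
      then have "k \<in> C" "m \<in> C" using glue_upper[OF V(1), of i] by auto
      then have "crossing V C" unfolding crossing_def using * by blast
      then show False using nc_partitions_not_crossing[OF \<rho>, of V C] V glue_C(1) by auto
    qed
  qed
  have 3: "\<not> crossing V W" "\<not> crossing W V" if V: "V \<in> \<pi>" and W: "W \<in> \<rho>" for V W
  proof -
    have "x < y" if "x \<in> V" "y \<in> W" for x y
      using glue_lower[OF V that(1)] glue_upper[OF W that(2)] by auto
    then show "\<not> crossing V W" "\<not> crossing W V"
      unfolding crossing_def by (metis order_less_asym)+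
  qed
  consider "B = insert a C" | "B \<in> \<pi>" | "B \<in> \<rho>" "B \<noteq> C" using BD(1) by auto
  then show "\<not> crossing B D"
  proof cases
    assume "B = insert a C"
    then show ?thesis using BD(2,3) 1(1)[of D] 2(1)[of D] by auto
  next
    assume "B \<in> \<pi>"
    then show ?thesis
      using BD(2,3) 1(2)[of B] 3(1)[of B D] nc_partitions_not_crossing[OF \<pi>, of B D] by auto
  next
    assume "B \<in> \<rho>" "B \<noteq> C"
    then show ?thesis
      using BD(2,3) 2(2)[of B] 3(2)[of D B] nc_partitions_not_crossing[OF \<rho>, of B D] by auto
  qed
qed

lemma glue_singleton: "{a} \<notin> glue a j \<pi> \<rho>"
  unfolding glue_eq using glue_lower[of "{a}" a] glue_upper[of "{a}" a] glue_C by auto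

text \<open>From here to \<open>glue_snd\<close> the triple of \<open>j\<close>,
  \<open>\<pi>\<close> and \<open>\<rho>\<close> is read off the glued partition: the block of
  \<open>a\<close> gives \<open>C\<close>, its minimum is \<open>j\<close>, the blocks below
  \<open>j\<close> form \<open>\<pi>\<close>, and the rest together with \<open>C\<close> is
  \<open>\<rho>\<close>. This yields injectivity in \<open>nc_sum_insert\<close>.\<close>

lemma glue_block: "block_of (glue a j \<pi> \<rho>) a = insert a C"
  by (rule block_of_eq[OF glue_nc]) (auto simp: glue_eq)

lemma glue_Min: "finite A \<Longrightarrow> Min C = j"
  using glue_C by (intro Min_eqI) (auto intro: finite_subset)

lemma glue_fst: "\<pi> = {V \<in> glue a j \<pi> \<rho>. V \<subseteq> {..<j}}"
proof -
  have "V \<notin> \<rho>" if "V \<subseteq> {..<j}" for V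
  proof
    assume V: "V \<in> \<rho>"
    then obtain x where "x \<in> V" using nc_partitions_nonempty[OF \<rho>] by auto
    then show False using glue_upper[OF V] that by force
  qed
  moreover have "\<not> insert a C \<subseteq> {..<j}" using glue_C by auto
  moreover have "V \<subseteq> {..<j}" if "V \<in> \<pi>" for V using glue_lower[OF that] by auto
  ultimately show ?thesis unfolding glue_eq by blast
qed

lemma glue_snd: "\<rho> = insert C (glue a j \<pi> \<rho> - \<pi> - {insert a C})"
  unfolding glue_eq using glue_C(1) glue_notin by blast

text \<open>Every block of \<open>\<pi>\<close> is enclosed by \<open>a\<close> and
  \<open>j\<close>, even if it was outer in \<open>\<pi>\<close>. A block of \<open>\<rho>\<close>
  enclosed by \<open>insert a C\<close> lies above \<open>j\<close> and is therefore already
  enclosed by \<open>C\<close>, with \<open>j\<close> as lower witness.\<close>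

lemma Inn_glue: "Inn (glue a j \<pi> \<rho>) = \<pi> \<union> Inn \<rho>"
proof (intro equalityI subsetI)
  fix V assume "V \<in> Inn (glue a j \<pi> \<rho>)"
  then obtain W p q where V: "V \<in> glue a j \<pi> \<rho>" and W: "W \<in> glue a j \<pi> \<rho>" "W \<noteq> V" "p \<in> W" "q \<in> W"
    "\<forall>x\<in>V. p < x \<and> x < q" by (auto simp: Inn_def)
  have "p \<in> insert a A" using W(1,3) nc_partitions_subset[OF glue_nc, of W] by auto
  then have "a \<le> p" using lt by auto
  then have "V \<noteq> insert a C" using W(5) by auto
  show "V \<in> \<pi> \<union> Inn \<rho>"
  proof (cases "V \<in> \<pi>")
    case False
    then have V': "V \<in> \<rho>" "V \<noteq> C" using V \<open>V \<noteq> insert a C\<close> by (auto simp: glue_eq)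
    obtain x where x: "x \<in> V" using nc_partitions_nonempty[OF \<rho> V'(1)] by auto
    then have "j < x" "p < x" "x < q" using glue_upper_strict[OF V'] W(5) by auto
    then have "W \<notin> \<pi>" using glue_lower[of W q] W(4) by auto
    then consider "W = insert a C" | "W \<in> \<rho>" using W(1) by (auto simp: glue_eq)
    then show ?thesis
    proof cases
      case 1
      have "q \<in> C" using 1 W(4) \<open>x < q\<close> glue_upper[OF V'(1) x] by auto
      moreover have "\<forall>x\<in>V. j < x \<and> x < q" using W(5) glue_upper_strict[OF V'] by auto
      ultimately show ?thesis using V' glue_C(1,2) by (auto simp: Inn_def)
    next
      case 2
      then show ?thesis using W V' by (auto simp: Inn_def)
    qed
  qed auto
next
  fix V assume V: "V \<in> \<pi> \<union> Inn \<rho>"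
  show "V \<in> Inn (glue a j \<pi> \<rho>)"
  proof (cases "V \<in> \<pi>")
    case True
    then have "\<forall>x\<in>V. a < x \<and> x < j" using glue_lower by auto
    then show ?thesis using True glue_C(2) glue_notin by (auto simp: Inn_def glue_eq)
  next
    case False
    then obtain W p q where V': "V \<in> \<rho>" and W: "W \<in> \<rho>" "W \<noteq> V" "p \<in> W" "q \<in> W"
      "\<forall>x\<in>V. p < x \<and> x < q" using V by (auto simp: Inn_def)
    obtain x where x: "x \<in> V" using nc_partitions_nonempty[OF \<rho> V'(1)] by auto
    have "V \<noteq> C" using W(5) glue_upper[OF W(1,3)] glue_C(2) by force
    then have Vg: "V \<in> glue a j \<pi> \<rho>" using V' by (auto simp: glue_eq)
    show ?thesis
    proof (cases "W = C")
      case True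
      then have "p \<in> insert a C" "q \<in> insert a C" using W by auto
      moreover have "insert a C \<in> glue a j \<pi> \<rho>" by (simp add: glue_eq)
      moreover have "insert a C \<noteq> V" using V' glue_notin by auto
      ultimately show ?thesis using Vg W(5) unfolding Inn_def
        by (intro CollectI conjI bexI[of _ "insert a C"] bexI[of _ p] bexI[of _ q]) auto
    next
      case False
      then have "W \<in> glue a j \<pi> \<rho>" using W by (auto simp: glue_eq)
      then show ?thesis using W Vg by (auto simp: Inn_def)
    qed
  qed
qed

text \<open>Since gluing makes all of \<open>\<pi>\<close> inner, the gap is weighted by
  \<open>g\<close> alone; this is the origin of \<open>nc_sum g g g\<close> in the recursion
  below.\<close>

lemma prod_glue:
  assumes "finite A"
  shows "(\<Prod>B\<in>glue a j \<pi> \<rho>. if B \<in> Inn (glue a j \<pi> \<rho>) then g B else if a \<in> B then h B else f B)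
    = (\<Prod>B\<in>\<pi>. g B) * (\<Prod>B\<in>\<rho>. if B \<in> Inn \<rho> then g B else if j \<in> B then h (insert a B) else (f B :: 'b :: comm_ring_1))"
proof -
  let ?F = "\<lambda>B. if B \<in> Inn (glue a j \<pi> \<rho>) then g B else if a \<in> B then h B else f B"
  let ?G = "\<lambda>B. if B \<in> Inn \<rho> then g B else if j \<in> B then h (insert a B) else f B"
  have fin: "finite \<pi>" "finite \<rho>" using \<pi> \<rho> assms by (auto intro: finite_nc_partition[rotated])
  have "C \<notin> Inn \<rho>"
    using glue_upper glue_C(2) by (fastforce simp: Inn_def)
  then have GC: "?G C = h (insert a C)" using glue_C by auto
  have "insert a C \<notin> Inn (glue a j \<pi> \<rho>)"
    unfolding Inn_glue using glue_notin Inn_subset[of \<rho>] by auto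
  then have FC: "?F (insert a C) = h (insert a C)" by auto
  have 1: "?F B = g B" if "B \<in> \<pi>" for B using that by (simp add: Inn_glue)
  have 2: "?F B = ?G B" if "B \<in> \<rho> - {C}" for B
  proof -
    have "a \<notin> B" "j \<notin> B" using that glue_upper[of B a] glue_upper_strict[of B j] by auto
    moreover have "B \<notin> \<pi>" using glue_notin that by auto
    ultimately show ?thesis by (simp add: Inn_glue)
  qed
  have split: "prod F (glue a j \<pi> \<rho>) = F (insert a C) * (prod F \<pi> * prod F (\<rho> - {C}))" for F :: "nat set \<Rightarrow> 'b"
  proof -
    have "prod F (glue a j \<pi> \<rho>) = F (insert a C) * prod F (\<pi> \<union> (\<rho> - {C}))"
      unfolding glue_eq by (intro prod.insert) (use fin glue_notin in auto)
    also have "prod F (\<pi> \<union> (\<rho> - {C})) = prod F \<pi> * prod F (\<rho> - {C})"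
      by (intro prod.union_disjoint) (use fin glue_notin in auto)
    finally show ?thesis .
  qed
  have "prod ?F \<pi> = prod g \<pi>" by (rule prod.cong[OF refl 1])
  moreover have "prod ?F (\<rho> - {C}) = prod ?G (\<rho> - {C})" by (rule prod.cong[OF refl 2])
  ultimately have "prod ?F (glue a j \<pi> \<rho>) = h (insert a C) * (prod g \<pi> * prod ?G (\<rho> - {C}))"
    unfolding split FC by (simp only:)
  also have "\<dots> = prod g \<pi> * prod ?G \<rho>"
    unfolding prod.remove[OF fin(2) glue_C(1)] GC by (simp add: algebra_simps)
  finally show ?thesis .
qed

end

text \<open>With \<open>D\<close> the block of \<open>a\<close>, the set \<open>D - {a}\<close> is
  nonempty and \<open>j\<close> is its minimum. The cut at \<open>j\<close> respects all other
  blocks: one with points x < j < y would give a < x < j < y with \<open>a\<close> and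
  \<open>j\<close> in \<open>D\<close>, a crossing.\<close>

lemma unglue:
  assumes "finite A" and lt: "\<forall>x\<in>A. a < x"
    and P: "P \<in> nc_partitions (insert a A)" and na: "{a} \<notin> P"
  obtains j \<pi> \<rho> where "j \<in> A" "\<pi> \<in> nc_partitions (A \<inter> {..<j})" "\<rho> \<in> nc_partitions (A \<inter> {j..})"
    "P = glue a j \<pi> \<rho>"
proof -
  define D where "D = block_of P a"
  define C where "C = D - {a}"
  define j where "j = Min C"
  define \<pi> where "\<pi> = {V \<in> P. V \<subseteq> {..<j} \<and> V \<noteq> D}"
  define \<rho> where "\<rho> = insert C (P - \<pi> - {D})"
  have D: "D \<in> P" "a \<in> D" unfolding D_def using block_of_in[OF P, of a] by auto
  have aA: "a \<notin> A" using lt by auto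
  have C: "C \<noteq> {}" "C \<subseteq> A" "finite C" "D = insert a C" "a \<notin> C"
  proof -
    have "D \<noteq> {a}" using D na by auto
    then show "C \<noteq> {}" "D = insert a C" using D unfolding C_def by auto
    show "C \<subseteq> A" using nc_partitions_subset[OF P D(1)] unfolding C_def by auto
    then show "finite C" using assms(1) by (rule finite_subset)
    show "a \<notin> C" by (simp add: C_def)
  qed
  have j: "j \<in> C" unfolding j_def using C by auto
  have jmin: "j \<le> x" if "x \<in> C" for x unfolding j_def using C(3) that by simp
  have jA: "j \<in> A" using j C by auto
  have aj: "a < j" using jA lt by auto
  have outside: "x \<in> A" "x \<notin> C" if "V \<in> P" "V \<noteq> D" "x \<in> V" for V x
  proof -
    have "x \<notin> D" using nc_partitions_eq[OF P, of V D x] that D by auto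
    then show "x \<in> A" "x \<notin> C"
      using nc_partitions_subset[OF P that(1)] that(3) C(4) by auto
  qed
  have upper: "V \<subseteq> A \<inter> {j..}" if V: "V \<in> P" "V \<noteq> D" "\<not> V \<subseteq> {..<j}" for V
  proof
    fix x assume x: "x \<in> V"
    obtain y where y: "y \<in> V" "j \<le> y" using V(3) by (metis lessThan_iff linorder_not_less subsetI)
    have "j \<noteq> y" using outside(2)[OF V(1,2) y(1)] j by auto
    have "\<not> x < j"
    proof
      assume "x < j"
      moreover have "a < x" using lt outside(1)[OF V(1,2) x] by auto
      moreover have "j < y" using y \<open>j \<noteq> y\<close> by auto
      ultimately have "crossing D V"
        unfolding crossing_def using D(2) x y(1) j C(4) by blast
      then show False using nc_partitions_not_crossing[OF P, of D V] D V by auto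
    qed
    then show "x \<in> A \<inter> {j..}" using outside(1)[OF V(1,2) x] by auto
  qed
  have \<pi>: "\<pi> \<in> nc_partitions (A \<inter> {..<j})"
  proof (rule nc_partitionsI)
    show "\<Union>\<pi> = A \<inter> {..<j}"
    proof (intro equalityI subsetI)
      fix x assume "x \<in> \<Union>\<pi>"
      then show "x \<in> A \<inter> {..<j}" unfolding \<pi>_def using outside(1) by auto
    next
      fix x assume x: "x \<in> A \<inter> {..<j}"
      then have B: "block_of P x \<in> P" "x \<in> block_of P x" using block_of_in[OF P, of x] by auto
      have "x \<notin> C" using jmin[of x] x by auto
      then have nD: "block_of P x \<noteq> D" using B C(4) x aA by auto
      moreover have "block_of P x \<subseteq> {..<j}"
      proof (rule ccontr)
        assume "\<not> block_of P x \<subseteq> {..<j}"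
        then show False using upper[OF B(1) nD] B(2) x by auto
      qed
      ultimately show "x \<in> \<Union>\<pi>" using B by (auto simp: \<pi>_def)
    qed
  next
    fix B assume "B \<in> \<pi>" then show "B \<noteq> {}" using nc_partitions_nonempty[OF P] \<pi>_def by auto
  next
    fix B E x assume "B \<in> \<pi>" "E \<in> \<pi>" "x \<in> B" "x \<in> E"
    then show "B = E" using nc_partitions_eq[OF P, of B E x] by (auto simp: \<pi>_def)
  next
    fix B E assume "B \<in> \<pi>" "E \<in> \<pi>" "B \<noteq> E"
    then show "\<not> crossing B E" using nc_partitions_not_crossing[OF P, of B E] by (auto simp: \<pi>_def)
  qed
  have \<rho>_rest: "V \<in> P" "V \<noteq> D" "V \<subseteq> A \<inter> {j..}" if "V \<in> P - \<pi> - {D}" for V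
    using that upper[of V] by (auto simp: \<pi>_def)
  have C_not: "\<not> crossing C V" "\<not> crossing V C" if "V \<in> P" "V \<noteq> D" for V
    using nc_partitions_not_crossing[OF P, of D V] nc_partitions_not_crossing[OF P, of V D] that D
    unfolding C(4) crossing_def by (blast+)
  have \<rho>: "\<rho> \<in> nc_partitions (A \<inter> {j..})"
  proof (rule nc_partitionsI)
    show "\<Union>\<rho> = A \<inter> {j..}"
    proof (intro equalityI subsetI)
      fix x assume "x \<in> \<Union>\<rho>"
      then obtain V where V: "V \<in> \<rho>" "x \<in> V" by auto
      show "x \<in> A \<inter> {j..}"
      proof (cases "V = C")
        case True
        then show ?thesis using V(2) C(2) jmin by auto
      next
        case False
        then show ?thesis using V \<rho>_rest(3)[of V] by (auto simp: \<rho>_def)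
      qed
    next
      fix x assume x: "x \<in> A \<inter> {j..}"
      then have B: "block_of P x \<in> P" "x \<in> block_of P x" using block_of_in[OF P, of x] by auto
      show "x \<in> \<Union>\<rho>"
      proof (cases "block_of P x = D")
        case True
        then have "x \<in> C" using B(2) x aA C(4) by auto
        then show ?thesis by (simp add: \<rho>_def)
      next
        case False
        moreover have "\<not> block_of P x \<subseteq> {..<j}" using B x by auto
        ultimately show ?thesis using B by (auto simp: \<rho>_def \<pi>_def)
      qed
    qed
  next
    fix B assume "B \<in> \<rho>" then show "B \<noteq> {}" using nc_partitions_nonempty[OF P] C(1) by (auto simp: \<rho>_def)
  next
    fix B E x assume BE: "B \<in> \<rho>" "E \<in> \<rho>" and x: "x \<in> B" "x \<in> E"
    have *: "x \<notin> C" if "V \<in> P - \<pi> - {D}" "x \<in> V" for V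
      using outside(2)[of V x] that by auto
    consider "B = C" | "B \<in> P - \<pi> - {D}" using BE by (auto simp: \<rho>_def)
    then show "B = E"
    proof cases
      assume "B = C"
      then show ?thesis using BE(2) x *[of E] by (auto simp: \<rho>_def)
    next
      assume "B \<in> P - \<pi> - {D}"
      then show ?thesis using BE(2) x *[of B] nc_partitions_eq[OF P, of B E x] by (auto simp: \<rho>_def)
    qed
  next
    fix B E assume BE: "B \<in> \<rho>" "E \<in> \<rho>" "B \<noteq> E"
    consider "B = C" | "B \<in> P - \<pi> - {D}" using BE by (auto simp: \<rho>_def)
    then show "\<not> crossing B E"
    proof cases
      assume "B = C"
      then show ?thesis using BE(2,3) C_not(1)[of E] by (auto simp: \<rho>_def)
    next
      assume "B \<in> P - \<pi> - {D}"
      then show ?thesis using BE(2,3) C_not(2)[of B] nc_partitions_not_crossing[OF P, of B E]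
        by (auto simp: \<rho>_def)
    qed
  qed
  have "block_of \<rho> j = C" by (rule block_of_eq[OF \<rho>]) (auto simp: \<rho>_def j)
  moreover have "C \<notin> P - \<pi> - {D}"
  proof
    assume "C \<in> P - \<pi> - {D}"
    then show False using outside(2)[of C j] j by auto
  qed
  ultimately have "glue a j \<pi> \<rho> = insert D (\<pi> \<union> (P - \<pi> - {D}))"
    unfolding glue_def \<rho>_def C(4) by auto
  also have "\<dots> = P" using D(1) by (auto simp: \<pi>_def)
  finally show thesis using that jA \<pi> \<rho> by metis
qed

text \<open>Decomposition of a non-crossing partition at the second element \<open>j\<close> of the block of the
  least element \<open>a\<close>: everything strictly between \<open>a\<close> and \<open>j\<close> is nested inside that block.\<close>

lemma nc_sum_insert:
  fixes f g h :: "nat set \<Rightarrow> 'b::comm_ring_1"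
  assumes fin: "finite A" and lt: "\<forall>x\<in>A. a < x"
  shows "nc_sum h f g (insert a A) = h {a} * nc_sum f f g A +
    (\<Sum>j\<in>A. nc_sum g g g (A \<inter> {..<j}) * nc_sum (\<lambda>B. h (insert a B)) f g (A \<inter> {j..}))"
proof -
  define F where "F P = (\<Prod>B\<in>P. if B \<in> Inn P then g B else if a \<in> B then h B else f B)" for P
  define G where "G j \<rho> = (\<Prod>B\<in>\<rho>. if B \<in> Inn \<rho> then g B else if j \<in> B then h (insert a B) else f B)" for j \<rho>
  define P0 where "P0 = {P \<in> nc_partitions (insert a A). {a} \<in> P}"
  define P1 where "P1 = {P \<in> nc_partitions (insert a A). {a} \<notin> P}"
  have aA: "a \<notin> A" using lt by auto
  have Mina: "Min (insert a A) = a"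
    using fin lt by (intro Min_eqI) (auto intro: less_imp_le)
  have finP: "finite (nc_partitions (insert a A))" using fin by (intro finite_nc_partitions) auto
  have "nc_sum h f g (insert a A) = sum F (nc_partitions (insert a A))"
    unfolding nc_sum_def F_def Mina ..
  also have "nc_partitions (insert a A) = P0 \<union> P1" by (auto simp: P0_def P1_def)
  also have "sum F (P0 \<union> P1) = sum F P0 + sum F P1"
    by (rule sum.union_disjoint) (use finP in \<open>auto simp: P0_def P1_def\<close>)
  also have "sum F P0 = h {a} * nc_sum f f g A"
  proof -
    have eq: "P0 = insert {a} ` nc_partitions A"
      unfolding P0_def by (rule nc_partitions_insert_singleton[OF aA lt])
    have notin: "{a} \<notin> \<pi>" if "\<pi> \<in> nc_partitions A" for \<pi>
      using nc_partitions_subset[OF that] aA by auto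
    have "inj_on (insert {a}) (nc_partitions A)"
      by (rule inj_onI) (use notin in \<open>metis insert_ident\<close>)
    then have "sum F P0 = (\<Sum>\<pi>\<in>nc_partitions A. F (insert {a} \<pi>))"
      unfolding eq by (rule sum.reindex_cong) auto
    also have "\<dots> = (\<Sum>\<pi>\<in>nc_partitions A. h {a} * (\<Prod>B\<in>\<pi>. if B \<in> Inn \<pi> then g B else f B))"
    proof (rule sum.cong[OF refl])
      fix \<pi> assume \<pi>: "\<pi> \<in> nc_partitions A"
      have aB: "a \<notin> B" if "B \<in> \<pi>" for B using nc_partitions_subset[OF \<pi> that] aA by auto
      have nI: "{a} \<notin> Inn \<pi>" using Inn_subset[of \<pi>] notin[OF \<pi>] by auto
      have "F (insert {a} \<pi>) = h {a} * (\<Prod>B\<in>\<pi>. if B \<in> Inn \<pi> then g B else if a \<in> B then h B else f B)"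
        unfolding F_def Inn_insert_singleton[OF \<pi> lt]
        using notin[OF \<pi>] finite_nc_partition[OF fin \<pi>] nI by simp
      also have "(\<Prod>B\<in>\<pi>. if B \<in> Inn \<pi> then g B else if a \<in> B then h B else f B) =
          (\<Prod>B\<in>\<pi>. if B \<in> Inn \<pi> then g B else f B)"
        by (rule prod.cong) (use aB in auto)
      finally show "F (insert {a} \<pi>) = h {a} * (\<Prod>B\<in>\<pi>. if B \<in> Inn \<pi> then g B else f B)" .
    qed
    \<comment> \<open>Once \<open>{a}\<close> is removed, the block of the least element of
      \<open>A\<close> is an ordinary outer block, so \<open>f\<close> fills the place of the
      special weight.\<close>
    also have "\<dots> = h {a} * nc_sum f f g A"
      by (simp add: nc_sum_def sum_distrib_left cong: if_cong)
    finally show ?thesis .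
  qed
  also have "sum F P1 = (\<Sum>j\<in>A. nc_sum g g g (A \<inter> {..<j}) * nc_sum (\<lambda>B. h (insert a B)) f g (A \<inter> {j..}))"
  proof -
    define Sig where "Sig = (SIGMA j:A. nc_partitions (A \<inter> {..<j}) \<times> nc_partitions (A \<inter> {j..}))"
    define gl where "gl = (\<lambda>(j, \<pi>, \<rho>). glue a j \<pi> \<rho>)"
    have inj: "inj_on gl Sig"
    proof (rule inj_onI)
      fix x y assume "x \<in> Sig" "y \<in> Sig" and eq: "gl x = gl y"
      then obtain j \<pi> \<rho> j' \<pi>' \<rho>' where xy: "x = (j, \<pi>, \<rho>)" "y = (j', \<pi>', \<rho>')"
        and 1: "j \<in> A" "\<pi> \<in> nc_partitions (A \<inter> {..<j})" "\<rho> \<in> nc_partitions (A \<inter> {j..})"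
        and 2: "j' \<in> A" "\<pi>' \<in> nc_partitions (A \<inter> {..<j'})" "\<rho>' \<in> nc_partitions (A \<inter> {j'..})"
        by (auto simp: Sig_def)
      have eq': "glue a j \<pi> \<rho> = glue a j' \<pi>' \<rho>'" using eq by (simp add: gl_def xy)
      have "insert a (block_of \<rho> j) = insert a (block_of \<rho>' j')"
        using glue_block[OF lt 1 refl] glue_block[OF lt 2 refl] eq' by simp
      then have C: "block_of \<rho> j = block_of \<rho>' j'"
        using glue_C(4)[OF lt 1 refl] glue_C(4)[OF lt 2 refl] by (metis insert_ident)
      have j: "j = j'"
        using glue_Min[OF lt 1 refl fin] glue_Min[OF lt 2 refl fin] C by simp
      have \<pi>: "\<pi> = \<pi>'"
        using glue_fst[OF lt 1 refl] glue_fst[OF lt 2 refl] eq' j by simp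
      have "\<rho> = \<rho>'"
        using glue_snd[OF lt 1 refl] glue_snd[OF lt 2 refl] eq' \<pi> C by simp
      then show "x = y" using j \<pi> xy by simp
    qed
    have img: "P1 = gl ` Sig"
    proof (intro equalityI subsetI)
      fix P assume "P \<in> P1"
      then show "P \<in> gl ` Sig"
        unfolding P1_def by (auto elim!: unglue[OF fin lt] simp: Sig_def gl_def image_iff)
    next
      fix P assume "P \<in> gl ` Sig"
      then obtain j \<pi> \<rho> where "P = glue a j \<pi> \<rho>"
        and 1: "j \<in> A" "\<pi> \<in> nc_partitions (A \<inter> {..<j})" "\<rho> \<in> nc_partitions (A \<inter> {j..})"
        by (auto simp: Sig_def gl_def)
      then show "P \<in> P1"
        using glue_nc[OF lt 1 refl] glue_singleton[OF lt 1 refl] by (simp add: P1_def)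
    qed
    have "sum F P1 = sum (F \<circ> gl) Sig" unfolding img by (rule sum.reindex[OF inj])
    also have "\<dots> = (\<Sum>(j, \<pi>, \<rho>)\<in>Sig. (\<Prod>B\<in>\<pi>. g B) * G j \<rho>)"
    proof (rule sum.cong[OF refl])
      fix x assume "x \<in> Sig"
      then obtain j \<pi> \<rho> where x: "x = (j, \<pi>, \<rho>)"
        and 1: "j \<in> A" "\<pi> \<in> nc_partitions (A \<inter> {..<j})" "\<rho> \<in> nc_partitions (A \<inter> {j..})"
        by (auto simp: Sig_def)
      show "(F \<circ> gl) x = (case x of (j, \<pi>, \<rho>) \<Rightarrow> (\<Prod>B\<in>\<pi>. g B) * G j \<rho>)"
        unfolding x using prod_glue[OF lt 1 refl fin, of g h f]
        by (simp add: F_def gl_def G_def)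
    qed
    also have "\<dots> = (\<Sum>j\<in>A. \<Sum>(\<pi>, \<rho>)\<in>nc_partitions (A \<inter> {..<j}) \<times> nc_partitions (A \<inter> {j..}). (\<Prod>B\<in>\<pi>. g B) * G j \<rho>)"
      unfolding Sig_def by (rule sum.Sigma[symmetric]) (use fin in \<open>auto intro!: finite_nc_partitions\<close>)
    also have "\<dots> = (\<Sum>j\<in>A. nc_sum g g g (A \<inter> {..<j}) * nc_sum (\<lambda>B. h (insert a B)) f g (A \<inter> {j..}))"
    proof (rule sum.cong[OF refl])
      fix j assume "j \<in> A"
      then have Minj: "Min (A \<inter> {j..}) = j" using fin by (intro Min_eqI) auto
      have "nc_sum (\<lambda>B. h (insert a B)) f g (A \<inter> {j..}) = (\<Sum>\<rho>\<in>nc_partitions (A \<inter> {j..}). G j \<rho>)"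
        unfolding nc_sum_def G_def Minj ..
      then show "(\<Sum>(\<pi>, \<rho>)\<in>nc_partitions (A \<inter> {..<j}) \<times> nc_partitions (A \<inter> {j..}). (\<Prod>B\<in>\<pi>. g B) * G j \<rho>)
        = nc_sum g g g (A \<inter> {..<j}) * nc_sum (\<lambda>B. h (insert a B)) f g (A \<inter> {j..})"
        by (simp add: nc_sum_all_eq sum_product sum.cartesian_product)
    qed
    finally show ?thesis .
  qed
  finally show ?thesis .
qed

section \<open>Generating series for weights depending only on block sizes\<close>

text \<open>\<open>k\<close> is the number of points of the first block that have been removed on
  its left; the cumulant of that block still sees its full size.\<close>

definition nc_card_sum :: "(nat \<Rightarrow> 'b::comm_ring_1) \<Rightarrow> (nat \<Rightarrow> 'b) \<Rightarrow> nat \<Rightarrow> nat set \<Rightarrow> 'b" where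
  "nc_card_sum R r k = nc_sum (\<lambda>B. R (k + card B)) (\<lambda>B. R (card B)) (\<lambda>B. r (card B))"

lemma nc_card_sum_empty [simp]: "nc_card_sum R r k {} = 1"
  by (simp add: nc_card_sum_def)

lemma nc_card_sum_insert:
  "nc_card_sum R r k {a..<a + Suc n} = R (Suc k) * nc_card_sum R r 0 {Suc a..<Suc a + n} +
    (\<Sum>i<n. nc_card_sum r r 0 {Suc a..<Suc a + i} * nc_card_sum R r (Suc k) {Suc a + i..<Suc a + n})"
proof -
  let ?A = "{Suc a..<Suc a + n}"
  have "{a..<a + Suc n} = insert a ?A" by auto
  then have "nc_card_sum R r k {a..<a + Suc n} = R (Suc k) * nc_card_sum R r 0 ?A +
      (\<Sum>j\<in>?A. nc_card_sum r r 0 (?A \<inter> {..<j}) *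
        nc_sum (\<lambda>B. R (k + card (insert a B))) (\<lambda>B. R (card B)) (\<lambda>B. r (card B)) (?A \<inter> {j..}))"
    unfolding nc_card_sum_def by (simp add: nc_sum_insert)
  also have "(\<Sum>j\<in>?A. nc_card_sum r r 0 (?A \<inter> {..<j}) *
        nc_sum (\<lambda>B. R (k + card (insert a B))) (\<lambda>B. R (card B)) (\<lambda>B. r (card B)) (?A \<inter> {j..}))
     = (\<Sum>j\<in>?A. nc_card_sum r r 0 {Suc a..<j} * nc_card_sum R r (Suc k) {j..<Suc a + n})"
  proof (rule sum.cong[OF refl])
    fix j assume j: "j \<in> ?A"
    have eq: "?A \<inter> {..<j} = {Suc a..<j}" "?A \<inter> {j..} = {j..<Suc a + n}" using j by auto
    \<comment> \<open>The removed point \<open>a\<close> passes from the block into the offset,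
      which becomes \<open>Suc k\<close>.\<close>
    have "card (insert a B) = Suc (card B)" if "B \<subseteq> {j..<Suc a + n}" for B
      using that j finite_subset[OF that] by (intro card_insert_disjoint) auto
    then have "nc_sum (\<lambda>B. R (k + card (insert a B))) (\<lambda>B. R (card B)) (\<lambda>B. r (card B)) {j..<Suc a + n}
        = nc_card_sum R r (Suc k) {j..<Suc a + n}"
      unfolding nc_card_sum_def by (intro nc_sum_cong) auto
    then show "nc_card_sum r r 0 (?A \<inter> {..<j}) *
        nc_sum (\<lambda>B. R (k + card (insert a B))) (\<lambda>B. R (card B)) (\<lambda>B. r (card B)) (?A \<inter> {j..})
       = nc_card_sum r r 0 {Suc a..<j} * nc_card_sum R r (Suc k) {j..<Suc a + n}"
      unfolding eq by simp
  qed
  also have "\<dots> = (\<Sum>i<n. nc_card_sum r r 0 {Suc a..<Suc a + i} * nc_card_sum R r (Suc k) {Suc a + i..<Suc a + n})"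
    by (rule sum.reindex_bij_witness[of _ "\<lambda>i. Suc a + i" "\<lambda>j. j - Suc a"]) auto
  finally show ?thesis .
qed

text \<open>The recursion for \<open>n\<close> points involves the sums for \<open>r\<close> alone
  as well as those for \<open>R\<close> with a larger offset, both on fewer points. With separate
  hypotheses for the two, the step serves twice: once with \<open>R\<close> equal to
  \<open>r\<close>, then for general \<open>R\<close>.\<close>

lemma nc_card_sum_shift_step:
  assumes r: "\<And>i a. i < n \<Longrightarrow> nc_card_sum r r 0 {a..<a + i} = nc_card_sum r r 0 {..<i}"
    and R: "\<And>i k a. i < n \<Longrightarrow> nc_card_sum R r k {a..<a + i} = nc_card_sum R r k {..<i}"
  shows "nc_card_sum R r k {a..<a + n} = nc_card_sum R r k {..<n}"
proof (cases n)
  case (Suc m)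
  have *: "nc_card_sum R r k {a..<a + Suc m} = R (Suc k) * nc_card_sum R r 0 {..<m} +
    (\<Sum>i<m. nc_card_sum r r 0 {..<i} * nc_card_sum R r (Suc k) {..<m - i})" for a
  proof -
    have "nc_card_sum R r (Suc k) {Suc a + i..<Suc a + m} = nc_card_sum R r (Suc k) {..<m - i}" if "i < m" for i
      using R[of "m - i" "Suc k" "Suc a + i"] that Suc by simp
    then show ?thesis
      unfolding nc_card_sum_insert using r[where a="Suc a"] R[where a="Suc a"] Suc by simp
  qed
  show ?thesis using *[of a] *[of 0] Suc by (simp add: atLeast0LessThan)
qed simp

lemma nc_card_sum_shift: "nc_card_sum R r k {a..<a + n} = nc_card_sum R r k {..<n}"
proof -
  have "\<forall>k a. nc_card_sum r r k {a..<a + n} = nc_card_sum r r k {..<n}" for n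
    by (induction n rule: less_induct) (blast intro: nc_card_sum_shift_step)
  then have "\<forall>k a. nc_card_sum R r k {a..<a + n} = nc_card_sum R r k {..<n}"
    by (induction n rule: less_induct) (blast intro: nc_card_sum_shift_step)
  then show ?thesis by blast
qed

lemma nc_card_sum_Suc:
  "nc_card_sum R r k {..<Suc n} = R (Suc k) * nc_card_sum R r 0 {..<n} +
    (\<Sum>i<n. nc_card_sum r r 0 {..<i} * nc_card_sum R r (Suc k) {..<n - i})"
proof -
  have "nc_card_sum R r (Suc k) {Suc 0 + i..<Suc 0 + n} = nc_card_sum R r (Suc k) {..<n - i}" if "i < n" for i
    using nc_card_sum_shift[of R r "Suc k" "Suc 0 + i" "n - i"] that by simp
  then show ?thesis
    using nc_card_sum_insert[of R r k 0 n] nc_card_sum_shift[of R r 0 "Suc 0" n]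
      nc_card_sum_shift[of r r 0 "Suc 0"]
    by (simp add: atLeast0LessThan)
qed

definition nc_fps :: "(nat \<Rightarrow> 'b::comm_ring_1) \<Rightarrow> (nat \<Rightarrow> 'b) \<Rightarrow> 'b fps" where
  "nc_fps R r = Abs_fps (\<lambda>n. nc_card_sum R r 0 {..<n})"

text \<open>The constant coefficient is set to 0, although \<open>nc_card_sum\<close> of the empty
  set is 1: without points there is no first block that could carry the offset.\<close>

definition nc_fps_shifted :: "(nat \<Rightarrow> 'b::comm_ring_1) \<Rightarrow> (nat \<Rightarrow> 'b) \<Rightarrow> nat \<Rightarrow> 'b fps" where
  "nc_fps_shifted R r k = Abs_fps (\<lambda>n. if n = 0 then 0 else nc_card_sum R r k {..<n})"

lemma nc_fps_shifted_0: "nc_fps_shifted R r 0 = nc_fps R r - 1"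
  by (rule fps_ext) (simp add: nc_fps_shifted_def nc_fps_def)

text \<open>The first block either stops at its first point, and an arbitrary partition follows, or
  it continues after a gap, which \<open>nc_fps r r\<close> counts.\<close>

lemma nc_fps_shifted_rec:
  "nc_fps_shifted R r k = fps_X * (fps_const (R (Suc k)) * nc_fps R r) +
     fps_X * (nc_fps r r * nc_fps_shifted R r (Suc k))"
proof (rule fps_ext)
  fix n
  show "fps_nth (nc_fps_shifted R r k) n = fps_nth (fps_X * (fps_const (R (Suc k)) * nc_fps R r) +
     fps_X * (nc_fps r r * nc_fps_shifted R r (Suc k))) n"
  proof (cases n)
    case (Suc m)
    \<comment> \<open>The convolution has an extra term i = m, a gap without a next point of the
      block behind it. The zero constant coefficient removes it.\<close>
    have "(\<Sum>i=0..m. nc_card_sum r r 0 {..<i} * (if m - i = 0 then 0 else nc_card_sum R r (Suc k) {..<m - i}))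
        = (\<Sum>i<m. nc_card_sum r r 0 {..<i} * nc_card_sum R r (Suc k) {..<m - i})"
      by (rule sum.mono_neutral_cong_right) auto
    then show ?thesis
      unfolding Suc by (simp add: nc_fps_shifted_def nc_fps_def nc_card_sum_Suc fps_mult_nth[of "Abs_fps _"])
  qed (simp add: nc_fps_shifted_def)
qed

section \<open>Chains of positions: the sums behind the series \<open>C_par\<close>\<close>

definition chains_to :: "nat \<Rightarrow> nat list set" where
  "chains_to n = {s. s \<noteq> [] \<and> sorted_wrt (<) s \<and> hd s = 1 \<and> last s = n}"

definition chain_weight :: "(nat \<Rightarrow> 'b::comm_ring_1) \<Rightarrow> nat list \<Rightarrow> 'b" where
  "chain_weight m s = (\<Prod>i<length s - 1. m (s ! Suc i - 1 - s ! i))"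

text \<open>A chain lists the positions of the first block. For \<open>k = 0\<close> and
  \<open>n \<ge> 2\<close> this is \<open>phi_par\<close>; at \<open>n = 1\<close> the one-point
  chain contributes as well. The offset matches that of \<open>nc_card_sum\<close>, so that the two
  recursions can be compared.\<close>

definition chain_sum :: "(nat \<Rightarrow> 'b::comm_ring_1) \<Rightarrow> (nat \<Rightarrow> 'b) \<Rightarrow> nat \<Rightarrow> nat \<Rightarrow> 'b" where
  "chain_sum R m k n = (\<Sum>s\<in>chains_to n. R (k + length s) * chain_weight m s)"

lemma le_last_of_sorted: "sorted_wrt (<) t \<Longrightarrow> x \<in> set t \<Longrightarrow> x \<le> last (t :: nat list)"
  by (induction t) (auto intro: less_imp_le)

lemma chains_to_eq:
  "chains_to n = (if n = 1 then {[1]} else {}) \<union> (\<Union>j\<in>{1..<n}. (\<lambda>t. t @ [n]) ` chains_to j)"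
proof (intro equalityI subsetI)
  fix s assume s: "s \<in> chains_to n"
  then obtain t where t: "s = t @ [n]"
    unfolding chains_to_def by (metis (mono_tags, lifting) append_butlast_last_id mem_Collect_eq)
  show "s \<in> (if n = 1 then {[1]} else {}) \<union> (\<Union>j\<in>{1..<n}. (\<lambda>t. t @ [n]) ` chains_to j)"
  proof (cases "t = []")
    case True
    then show ?thesis using s t by (auto simp: chains_to_def)
  next
    case False
    have srt: "sorted_wrt (<) t" "last t < n" and hd: "hd t = 1"
      using s t False by (auto simp: chains_to_def sorted_wrt_append)
    then have "t \<in> chains_to (last t)" using False by (auto simp: chains_to_def)
    moreover have "1 \<le> last t"
    proof -
      have "hd t \<le> last t" using srt(1) False by (intro le_last_of_sorted) auto
      then show ?thesis using hd by simp
    qed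
    ultimately show ?thesis using t srt by auto
  qed
next
  fix s assume "s \<in> (if n = 1 then {[1]} else {}) \<union> (\<Union>j\<in>{1..<n}. (\<lambda>t. t @ [n]) ` chains_to j)"
  then consider "n = 1" "s = [1]" | j t where "j \<in> {1..<n}" "t \<in> chains_to j" "s = t @ [n]"
    by (auto split: if_splits)
  then show "s \<in> chains_to n"
  proof cases
    case 2
    then have "x \<le> j" if "x \<in> set t" for x
      using le_last_of_sorted[of t x] that by (auto simp: chains_to_def)
    then show ?thesis using 2 by (fastforce simp: chains_to_def sorted_wrt_append)
  qed (simp add: chains_to_def)
qed

lemma finite_chains_to: "finite (chains_to n)"
proof (induction n rule: less_induct)
  case (less n)
  then show ?case by (subst chains_to_eq) auto
qed

lemma length_chains_to: "s \<in> chains_to n \<Longrightarrow> length s \<le> n"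
proof (induction n arbitrary: s rule: less_induct)
  case (less n)
  from less.prems consider "n = 1" "s = [1]" | j t where "j \<in> {1..<n}" "t \<in> chains_to j" "s = t @ [n]"
    by (subst (asm) chains_to_eq) (auto split: if_splits)
  then show ?case
  proof cases
    case 2
    then show ?thesis using less.IH[of j t] by auto
  qed simp
qed

lemma chain_weight_snoc:
  assumes "t \<noteq> []"
  shows "chain_weight m (t @ [n]) = chain_weight m t * m (n - 1 - last t)"
proof -
  obtain l where l: "length t = Suc l" using assms by (cases t) auto
  have "last t = t ! l" using assms l by (simp add: last_conv_nth)
  then show ?thesis
    using l by (simp add: chain_weight_def nth_append)
qed

text \<open>Here the last point of the chain is removed, whereas \<open>nc_card_sum_Suc\<close>
  removes the first point of the block. As only the size and the product of the gap weights count,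
  both ends lead to recursions of the same shape.\<close>

lemma chain_sum_rec:
  "chain_sum R m k n = (if n = 1 then R (Suc k) else 0) + (\<Sum>j\<in>{1..<n}. chain_sum R m (Suc k) j * m (n - 1 - j))"
proof -
  let ?w = "\<lambda>s. R (k + length s) * chain_weight m s"
  have "chain_sum R m k n = sum ?w (if n = 1 then {[1]} else {}) + sum ?w (\<Union>j\<in>{1..<n}. (\<lambda>t. t @ [n]) ` chains_to j)"
    unfolding chain_sum_def
    by (subst chains_to_eq, rule sum.union_disjoint) (auto simp: finite_chains_to)
  also have "sum ?w (if n = 1 then {[1]} else {}) = (if n = 1 then R (Suc k) else 0)"
    by (simp add: chain_weight_def)
  also have "sum ?w (\<Union>j\<in>{1..<n}. (\<lambda>t. t @ [n]) ` chains_to j) = (\<Sum>j\<in>{1..<n}. sum ?w ((\<lambda>t. t @ [n]) ` chains_to j))"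
    by (rule sum.UNION_disjoint) (auto simp: finite_chains_to, auto simp: chains_to_def)
  also have "\<dots> = (\<Sum>j\<in>{1..<n}. chain_sum R m (Suc k) j * m (n - 1 - j))"
  proof (rule sum.cong[OF refl])
    fix j
    have "sum ?w ((\<lambda>t. t @ [n]) ` chains_to j) = (\<Sum>t\<in>chains_to j. ?w (t @ [n]))"
      by (rule sum.reindex_cong[where l="\<lambda>t. t @ [n]"]) (auto simp: inj_on_def)
    also have "\<dots> = (\<Sum>t\<in>chains_to j. R (Suc k + length t) * chain_weight m t * m (n - 1 - j))"
      by (rule sum.cong[OF refl]) (auto simp: chains_to_def chain_weight_snoc mult.assoc)
    finally show "sum ?w ((\<lambda>t. t @ [n]) ` chains_to j) = chain_sum R m (Suc k) j * m (n - 1 - j)"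
      by (simp add: chain_sum_def sum_distrib_right)
  qed
  finally show ?thesis .
qed

lemma chain_fps_rec:
  "Abs_fps (chain_sum R m k) = fps_X * fps_const (R (Suc k)) +
     fps_X * (Abs_fps m * Abs_fps (chain_sum R m (Suc k)))"
proof (rule fps_ext)
  fix n
  show "fps_nth (Abs_fps (chain_sum R m k)) n = fps_nth (fps_X * fps_const (R (Suc k)) +
     fps_X * (Abs_fps m * Abs_fps (chain_sum R m (Suc k)))) n"
  proof (cases n)
    case 0
    then show ?thesis by (simp add: chain_sum_rec[of R m k 0])
  next
    case (Suc l)
    have "(\<Sum>i=0..l. m i * chain_sum R m (Suc k) (l - i)) = (\<Sum>i=0..l. m (l - i) * chain_sum R m (Suc k) i)"
      by (rule sum.reindex_bij_witness[of _ "\<lambda>i. l - i" "\<lambda>i. l - i"]) auto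
    also have "\<dots> = (\<Sum>j\<in>{1..<Suc l}. chain_sum R m (Suc k) j * m (l - j))"
      by (rule sum.mono_neutral_cong_right) (auto simp: chain_sum_rec[of R m _ 0] mult.commute not_le)
    finally have "fps_nth (Abs_fps m * Abs_fps (chain_sum R m (Suc k))) l =
        (\<Sum>j\<in>{1..<Suc l}. chain_sum R m (Suc k) j * m (l - j))"
      by (simp add: fps_mult_nth)
    then show ?thesis
      unfolding Suc by (simp add: chain_sum_rec[of R m k "Suc l"] del: sum.op_ivl_Suc)
  qed
qed

text \<open>Iteration shows that \<open>D k\<close> is divisible by every power of
  \<open>fps_X\<close>. The induction runs over the coefficient index for all \<open>k\<close> at
  once, because \<open>k\<close> grows along the recursion.\<close>

lemma fps_X_rec_zero:
  fixes D :: "nat \<Rightarrow> 'b::comm_ring_1 fps"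
  assumes "\<And>k. D k = fps_X * (N * D (Suc k))"
  shows "D k = 0"
proof -
  have "\<forall>k. fps_nth (D k) n = 0" for n
  proof (induction n rule: less_induct)
    case (less n)
    show ?case
    proof
      fix k
      show "fps_nth (D k) n = 0"
      proof (cases n)
        case 0
        then show ?thesis by (subst assms) simp
      next
        case (Suc l)
        then have "fps_nth (N * D (Suc k)) l = 0" using less by (simp add: fps_mult_nth)
        then show ?thesis using Suc by (subst assms) simp
      qed
    qed
  qed
  then show ?thesis by (simp add: fps_eq_iff)
qed

text \<open>The chain describes the first block with its gaps filled; behind its last point follows
  an arbitrary partition, hence the factor \<open>nc_fps R r\<close>. Both sides satisfy
  \<open>nc_fps_shifted_rec\<close>, so their difference satisfies the homogeneous recursion of
  \<open>fps_X_rec_zero\<close>.\<close>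

lemma nc_fps_shifted_eq:
  fixes R r m :: "nat \<Rightarrow> 'b::comm_ring_1"
  assumes "Abs_fps m = nc_fps r r"
  shows "nc_fps_shifted R r k = Abs_fps (chain_sum R m k) * nc_fps R r"
proof -
  define D where "D k = nc_fps_shifted R r k - Abs_fps (chain_sum R m k) * nc_fps R r" for k
  have "D k = fps_X * (nc_fps r r * D (Suc k))" for k
    unfolding D_def by (subst nc_fps_shifted_rec, subst chain_fps_rec) (simp add: assms algebra_simps)
  then have "D k = 0" by (rule fps_X_rec_zero)
  then show ?thesis by (simp add: D_def)
qed

section \<open>Multilinearity of the cumulants and mixed moments\<close>

definition complex_linear :: "('a::complex_star_algebra \<Rightarrow> complex) \<Rightarrow> bool" where
  "complex_linear F \<longleftrightarrow> (\<forall>c d x y. F (c *\<^sub>C x + d *\<^sub>C y) = c * F x + d * F y)"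

lemma complex_linearD: "complex_linear F \<Longrightarrow> F (c *\<^sub>C x + d *\<^sub>C y) = c * F x + d * F y"
  by (simp add: complex_linear_def)

lemma complex_linear_add: "complex_linear F \<Longrightarrow> F (x + y) = F x + F y"
  using complex_linearD[of F 1 x 1 y] by (simp add: scaleC_one)

lemma scaleC_zero_left: "0 *\<^sub>C (x::'a::complex_star_algebra) = 0"
  using scaleC_add_left[of 0 0 x] by simp

lemma scaleC_minus_left: "(- c) *\<^sub>C (x::'a::complex_star_algebra) = - (c *\<^sub>C x)"
  using scaleC_add_left[of "- c" c x] by (simp add: scaleC_zero_left eq_neg_iff_add_eq_0)

lemma complex_linear_scale: "complex_linear F \<Longrightarrow> F (c *\<^sub>C x) = c * F x"
  using complex_linearD[of F c x 0 x] by (simp add: scaleC_zero_left)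

lemma state_complex_linear: "state \<phi> \<Longrightarrow> complex_linear \<phi>"
  by (auto simp: state_def complex_linear_def Vector_Spaces.linear_iff)

lemma complex_linear_diff:
  "complex_linear F \<Longrightarrow> complex_linear G \<Longrightarrow> complex_linear (\<lambda>v. F v - G v)"
  by (simp add: complex_linear_def algebra_simps)

lemma complex_linear_mult_right: "complex_linear F \<Longrightarrow> complex_linear (\<lambda>v. F v * c)"
  by (simp add: complex_linear_def algebra_simps)

lemma complex_linear_sum:
  "(\<And>i. i \<in> I \<Longrightarrow> complex_linear (F i)) \<Longrightarrow> complex_linear (\<lambda>v. \<Sum>i\<in>I. F i v)"
  by (simp add: complex_linear_def sum.distrib sum_distrib_left)

lemma complex_linear_prod_list:
  "complex_linear F \<Longrightarrow> complex_linear (\<lambda>v. F (prod_list (us @ v # ws)))"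
  by (simp add: complex_linear_def distrib_left distrib_right mult_scaleC_left mult_scaleC_right)

lemma nths_middle:
  "nths (us @ v # ws) B =
     nths us B @ (if length us \<in> B then [v] else []) @ nths ws {j. Suc (j + length us) \<in> B}"
  by (simp add: nths_append nths_Cons)

text \<open>The varying slot lies in exactly one block, and the factors of all other blocks are
  constants. \<open>K\<close> may depend on the block so that inner and outer cumulants are covered
  together.\<close>

lemma complex_linear_prod_blocks:
  assumes \<pi>: "\<pi> \<in> NC n" and n: "length us < n"
    and K: "\<And>B. B \<in> \<pi> \<Longrightarrow> length us \<in> B \<Longrightarrow>
      complex_linear (\<lambda>v. K B (nths us B @ v # nths ws {j. Suc (j + length us) \<in> B}))"
  shows "complex_linear (\<lambda>v. \<Prod>B\<in>\<pi>. K B (nths (us @ v # ws) B))"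
proof -
  have \<pi>': "\<pi> \<in> nc_partitions {..<n}" using \<pi> by (simp add: NC_eq)
  obtain B where B: "B \<in> \<pi>" "length us \<in> B"
    using block_of_in[OF \<pi>', of "length us"] n by auto
  have "length us \<notin> D" if "D \<in> \<pi> - {B}" for D
    using nc_partitions_eq[OF \<pi>', of D B "length us"] that B by auto
  then have "(\<Prod>D\<in>\<pi> - {B}. K D (nths (us @ v # ws) D)) =
      (\<Prod>D\<in>\<pi> - {B}. K D (nths us D @ nths ws {j. Suc (j + length us) \<in> D}))" for v
    by (intro prod.cong) (auto simp: nths_middle)
  then have "(\<lambda>v. \<Prod>B\<in>\<pi>. K B (nths (us @ v # ws) B)) =
      (\<lambda>v. K B (nths us B @ v # nths ws {j. Suc (j + length us) \<in> B}) *
        (\<Prod>D\<in>\<pi> - {B}. K D (nths us D @ nths ws {j. Suc (j + length us) \<in> D})))"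
    using B by (simp add: prod.remove[OF finite_block_set[OF \<pi>] B(1)] nths_middle)
  then show ?thesis using complex_linear_mult_right[OF K[OF B]] by simp
qed

lemma length_block_middle:
  fixes us ws :: "'a list"
  assumes "\<pi> \<in> NC (Suc (length us + length ws))" "\<pi> \<noteq> {{..<Suc (length us + length ws)}}"
    and "B \<in> \<pi>" "length us \<in> B"
  shows "length (nths us B) + length (nths ws {j. Suc (j + length us) \<in> B}) < length us + length ws"
  \<comment> \<open>\<open>undefined\<close> merely occupies the slot; the lengths do not depend on
    its value.\<close>
  using length_nths_block[of \<pi> "us @ undefined # ws" B] assms by (simp add: nths_middle)

text \<open>The recursion writes the cumulant as a moment minus products over proper blocks.
  Restricting to a block shortens the entries on both sides of the slot, so the induction is on
  their total number with both lists arbitrary.\<close>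

lemma free_cumulant_linear:
  assumes "complex_linear \<psi>"
  shows "complex_linear (\<lambda>v. free_cumulant \<psi> (us @ v # ws))"
proof (induction "length us + length ws" arbitrary: us ws rule: less_induct)
  case less
  let ?N = "NC (Suc (length us + length ws)) - {{{..<Suc (length us + length ws)}}}"
  have "free_cumulant \<psi> (us @ v # ws) = \<psi> (prod_list (us @ v # ws)) -
      (\<Sum>\<pi>\<in>?N. \<Prod>B\<in>\<pi>. free_cumulant \<psi> (nths (us @ v # ws) B))" for v
    by (subst free_cumulant.simps) simp
  moreover have "complex_linear (\<lambda>v. \<psi> (prod_list (us @ v # ws)) -
      (\<Sum>\<pi>\<in>?N. \<Prod>B\<in>\<pi>. free_cumulant \<psi> (nths (us @ v # ws) B)))"
  proof (intro complex_linear_diff complex_linear_sum complex_linear_prod_list assms)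
    fix \<pi> assume \<pi>: "\<pi> \<in> ?N"
    show "complex_linear (\<lambda>v. \<Prod>B\<in>\<pi>. free_cumulant \<psi> (nths (us @ v # ws) B))"
      by (rule complex_linear_prod_blocks[where K="\<lambda>B. free_cumulant \<psi>" and n="Suc (length us + length ws)"])
        (use \<pi> length_block_middle[of \<pi> us ws] less in auto)
  qed
  ultimately show ?case by presburger
qed

lemma two_state_cumulant_linear:
  assumes "complex_linear \<phi>" "complex_linear \<psi>"
  shows "complex_linear (\<lambda>v. two_state_cumulant \<phi> \<psi> (us @ v # ws))"
proof (induction "length us + length ws" arbitrary: us ws rule: less_induct)
  case less
  let ?N = "NC (Suc (length us + length ws)) - {{{..<Suc (length us + length ws)}}}"
  \<comment> \<open>The products over \<open>Out\<close> and \<open>Inn\<close> become one product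
    over all blocks, which is the form treated by \<open>complex_linear_prod_blocks\<close>.\<close>
  define K where "K \<pi> B = (if B \<in> Inn \<pi> then free_cumulant \<psi> else two_state_cumulant \<phi> \<psi>)" for \<pi> B
  have K: "(\<Prod>B\<in>Out \<pi>. two_state_cumulant \<phi> \<psi> (xs B)) * (\<Prod>B\<in>Inn \<pi>. free_cumulant \<psi> (xs B)) =
      (\<Prod>B\<in>\<pi>. K \<pi> B (xs B))" if "\<pi> \<in> ?N" for \<pi> xs
  proof -
    have fin: "finite \<pi>" using that finite_block_set by blast
    show ?thesis unfolding prod_Out_Inn[OF fin] by (intro prod.cong refl) (simp add: K_def)
  qed
  have "two_state_cumulant \<phi> \<psi> (us @ v # ws) = \<phi> (prod_list (us @ v # ws)) -
      (\<Sum>\<pi>\<in>?N. \<Prod>B\<in>\<pi>. K \<pi> B (nths (us @ v # ws) B))" for v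
    by (subst two_state_cumulant.simps) (simp add: K)
  moreover have "complex_linear (\<lambda>v. \<phi> (prod_list (us @ v # ws)) -
      (\<Sum>\<pi>\<in>?N. \<Prod>B\<in>\<pi>. K \<pi> B (nths (us @ v # ws) B)))"
  proof (intro complex_linear_diff complex_linear_sum complex_linear_prod_list assms)
    fix \<pi> assume \<pi>: "\<pi> \<in> ?N"
    show "complex_linear (\<lambda>v. \<Prod>B\<in>\<pi>. K \<pi> B (nths (us @ v # ws) B))"
      by (rule complex_linear_prod_blocks[where n="Suc (length us + length ws)"])
        (use \<pi> length_block_middle[of \<pi> us ws] less free_cumulant_linear[OF assms(2)] in \<open>auto simp: K_def\<close>)
  qed
  ultimately show ?case by presburger
qed

section \<open>Cumulants of linear combinations of c-free elements\<close>

lemma c_free_elements_mixed: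
  assumes "c_free_elements \<phi> \<psi> X Y" "True \<in> set p" "False \<in> set p"
  shows "two_state_cumulant \<phi> \<psi> (map (\<lambda>b. if b then X else Y) p) = 0"
proof -
  let ?js = "map (\<lambda>b. if b then 1 else 2 :: nat) p"
  have hull: "x \<in> subalgebra hull {x}" for x :: 'a
    using hull_subset[of "{x}" subalgebra] by auto
  have "list_all2 (\<lambda>x j. j \<in> {1, 2} \<and> x \<in> subalgebra hull {if j = 1 then X else Y})
      (map (\<lambda>b. if b then X else Y) p) ?js"
    by (auto simp: list_all2_conv_all_nth hull)
  moreover have "1 \<in> set ?js" "2 \<in> set ?js" using assms(2,3) by force+
  then have "\<exists>i\<in>set ?js. \<exists>j\<in>set ?js. i \<noteq> j" by (metis one_eq_numeral_iff semiring_norm(85))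
  ultimately show ?thesis
    using assms(1) unfolding c_free_elements_def c_free_def by blast
qed

text \<open>Multilinear expansion from the left: \<open>p\<close> records the letters already
  chosen, \<open>l\<close> the combinations still to be expanded. As soon as \<open>p\<close>
  contains both letters the cumulant is mixed and both terms are 0, so only the two constant words
  survive. For the empty list these two words would coincide and be counted twice.\<close>

lemma two_state_cumulant_combinations:
  assumes "complex_linear \<phi>" "complex_linear \<psi>" "c_free_elements \<phi> \<psi> X Y" "p \<noteq> [] \<or> l \<noteq> []"
  shows "two_state_cumulant \<phi> \<psi> (map (\<lambda>b. if b then X else Y) p @ map (\<lambda>(c, d). c *\<^sub>C X + d *\<^sub>C Y) l) =
    (if False \<in> set p then 0
     else prod_list (map fst l) * two_state_cumulant \<phi> \<psi> (replicate (length p + length l) X)) +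
    (if True \<in> set p then 0
     else prod_list (map snd l) * two_state_cumulant \<phi> \<psi> (replicate (length p + length l) Y))"
  using assms(4)
proof (induction l arbitrary: p)
  case Nil
  have rep: "map (\<lambda>b. if b then X else Y) p = replicate (length p) (if b then X else Y)" if "(\<not> b) \<notin> set p" for b
  proof -
    have "x = b" if "x \<in> set p" for x
    proof -
      have "x \<noteq> (\<not> b)"
      proof
        assume eq: "x = (\<not> b)"
        show False using that \<open>(\<not> b) \<notin> set p\<close> unfolding eq by contradiction
      qed
      then show ?thesis by blast
    qed
    then show ?thesis by (intro replicate_eqI) auto
  qed
  show ?case
  proof (cases "True \<in> set p \<and> False \<in> set p")
    case True
    then show ?thesis using c_free_elements_mixed[OF assms(3), of p] by simp
  next
    case False
    moreover have "True \<in> set p \<or> False \<in> set p" using Nil by (cases p) auto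
    ultimately show ?thesis using rep[of True] rep[of False] by auto
  qed
next
  case (Cons cd l)
  obtain c d where cd: "cd = (c, d)" by (cases cd)
  let ?e = "\<lambda>b. if b then X else Y" and ?g = "\<lambda>(c, d). c *\<^sub>C X + d *\<^sub>C Y"
  have "two_state_cumulant \<phi> \<psi> (map ?e p @ map ?g (cd # l)) =
      c * two_state_cumulant \<phi> \<psi> (map ?e (p @ [True]) @ map ?g l) +
      d * two_state_cumulant \<phi> \<psi> (map ?e (p @ [False]) @ map ?g l)"
    using complex_linearD[OF two_state_cumulant_linear[OF assms(1,2), of "map ?e p" "map ?g l"], of c X d Y]
    by (simp add: cd)
  then show ?case
    using Cons.IH[of "p @ [True]"] Cons.IH[of "p @ [False]"] by (simp add: cd mult.assoc)
qed

section \<open>Moments as weighted partition sums\<close>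

lemma nths_replicate: "nths (replicate n x) A = replicate (card (A \<inter> {..<n})) x"
proof (rule replicate_eqI)
  have "{i. i < n \<and> i \<in> A} = A \<inter> {..<n}" by auto
  then show "length (nths (replicate n x) A) = card (A \<inter> {..<n})"
    by (simp add: length_nths)
qed (use set_nths_subset in fastforce)

lemma moment_eq_nc_card_sum:
  assumes "\<phi> 1 = 1"
  shows "\<phi> (S ^ n) = nc_card_sum (\<lambda>k. two_state_cumulant \<phi> \<psi> (replicate k S))
    (\<lambda>k. free_cumulant \<psi> (replicate k S)) 0 {..<n}"
proof (cases "n = 0")
  case False
  let ?R = "\<lambda>k. two_state_cumulant \<phi> \<psi> (replicate k S)" and ?r = "\<lambda>k. free_cumulant \<psi> (replicate k S)"
  have "\<phi> (S ^ n) = (\<Sum>\<pi> \<in> NC n. (\<Prod>B\<in>Out \<pi>. two_state_cumulant \<phi> \<psi> (nths (replicate n S) B)) *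
     (\<Prod>B\<in>Inn \<pi>. free_cumulant \<psi> (nths (replicate n S) B)))"
    using moment_two_state_cumulant[of "replicate n S" \<phi> \<psi>] False by simp
  also have "\<dots> = (\<Sum>\<pi>\<in>NC n. \<Prod>B\<in>\<pi>. if B \<in> Inn \<pi> then ?r (card B) else ?R (card B))"
  proof (rule sum.cong[OF refl])
    fix \<pi> assume \<pi>: "\<pi> \<in> NC n"
    have "B \<inter> {..<n} = B" if "B \<in> \<pi>" for B
      using nc_partitions_subset[of \<pi> "{..<n}" B] \<pi> that by (auto simp: NC_eq)
    then show "(\<Prod>B\<in>Out \<pi>. two_state_cumulant \<phi> \<psi> (nths (replicate n S) B)) *
       (\<Prod>B\<in>Inn \<pi>. free_cumulant \<psi> (nths (replicate n S) B)) =
       (\<Prod>B\<in>\<pi>. if B \<in> Inn \<pi> then ?r (card B) else ?R (card B))"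
      unfolding prod_Out_Inn[OF finite_block_set[OF \<pi>]] nths_replicate by (intro prod.cong) auto
  qed
  also have "\<dots> = nc_card_sum ?R ?r 0 {..<n}"
    by (simp add: nc_card_sum_def nc_sum_def NC_eq cong: if_cong)
  finally show ?thesis .
qed (simp add: assms)

lemma free_moment_eq_nc_card_sum:
  assumes "\<psi> 1 = 1"
  shows "\<psi> (S ^ n) = nc_card_sum (\<lambda>k. free_cumulant \<psi> (replicate k S))
    (\<lambda>k. free_cumulant \<psi> (replicate k S)) 0 {..<n}"
proof (cases "n = 0")
  case False
  have "\<psi> (S ^ n) = (\<Sum>\<pi> \<in> NC n. \<Prod>B\<in>\<pi>. free_cumulant \<psi> (nths (replicate n S) B))"
    using moment_free_cumulant[of "replicate n S" \<psi>] False by simp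
  also have "\<dots> = (\<Sum>\<pi>\<in>NC n. \<Prod>B\<in>\<pi>. free_cumulant \<psi> (replicate (card B) S))"
  proof (intro sum.cong prod.cong refl)
    fix \<pi> B assume "\<pi> \<in> NC n" "B \<in> \<pi>"
    then have "B \<inter> {..<n} = B"
      using nc_partitions_subset[of \<pi> "{..<n}" B] by (auto simp: NC_eq)
    then show "free_cumulant \<psi> (nths (replicate n S) B) = free_cumulant \<psi> (replicate (card B) S)"
      by (simp add: nths_replicate)
  qed
  also have "\<dots> = nc_card_sum (\<lambda>k. free_cumulant \<psi> (replicate k S)) (\<lambda>k. free_cumulant \<psi> (replicate k S)) 0 {..<n}"
    by (simp add: nc_card_sum_def nc_sum_all_eq NC_eq)
  finally show ?thesis .
qed (simp add: assms)

text \<open>The first block starts with \<open>V\<close>. If it avoids position 1, all its further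
  entries are \<open>S\<close> and \<open>V1\<close> annihilates it; the case \<open>k = 0\<close>
  covers the singleton. Otherwise both entries \<open>V\<close> lie in it, every other block sees
  only \<open>S\<close>, and the two positions act as one point with offset 1 among
  \<open>n + 1\<close> points.\<close>

lemma moment_first_two_linked:
  fixes \<phi> \<psi> :: "'a::complex_star_algebra \<Rightarrow> complex" and V S :: 'a
  defines "R \<equiv> \<lambda>k. two_state_cumulant \<phi> \<psi> (replicate k S)"
    and "r \<equiv> \<lambda>k. free_cumulant \<psi> (replicate k S)"
  assumes V1: "\<And>k. two_state_cumulant \<phi> \<psi> (V # replicate k S) = 0"
    and V2: "\<And>k. two_state_cumulant \<phi> \<psi> (V # V # replicate k S) = c * R (k + 2)"
  shows "\<phi> (V\<^sup>2 * S ^ n) = c * nc_card_sum R r 1 {..<Suc n}"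
proof -
  let ?xs = "V # V # replicate n S"
  let ?f = "\<lambda>B. two_state_cumulant \<phi> \<psi> (nths ?xs B)" and ?g = "\<lambda>B. free_cumulant \<psi> (nths ?xs B)"
  let ?A = "{1..<Suc (Suc n)}"
  have nths_xs: "nths ?xs B = (if 0 \<in> B then [V] else []) @ (if 1 \<in> B then [V] else []) @
      replicate (card (B - {0, 1})) S" if "B \<subseteq> {..<Suc (Suc n)}" for B
  proof -
    have "B - {0, 1} = (\<lambda>j. Suc (Suc j)) ` ({j. Suc (Suc j) \<in> B} \<inter> {..<n})"
    proof (intro equalityI subsetI)
      fix x assume x: "x \<in> B - {0, 1}"
      then obtain y where "x = Suc (Suc y)" by (metis DiffE insertCI not0_implies_Suc One_nat_def)
      then show "x \<in> (\<lambda>j. Suc (Suc j)) ` ({j. Suc (Suc j) \<in> B} \<inter> {..<n})" using x that by auto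
    qed auto
    then have "card (B - {0, 1}) = card ({j. Suc (Suc j) \<in> B} \<inter> {..<n})"
      by (simp add: card_image inj_on_def)
    then show ?thesis by (simp add: nths_Cons nths_replicate)
  qed
  have "\<phi> (V\<^sup>2 * S ^ n) = \<phi> (prod_list ?xs)"
    by (simp add: power2_eq_square mult.assoc)
  also have "\<dots> = (\<Sum>\<pi>\<in>NC (length ?xs). \<Prod>B\<in>\<pi>. if B \<in> Inn \<pi> then ?g B else ?f B)"
    by (subst moment_two_state_cumulant[where \<psi>=\<psi>])
      (auto intro!: sum.cong prod_Out_Inn finite_block_set)
  also have "\<dots> = nc_sum ?f ?f ?g (insert 0 ?A)"
  proof -
    have "{..<length ?xs} = insert 0 ?A" by auto
    then show ?thesis by (simp add: nc_sum_def NC_eq cong: if_cong del: lessThan_Suc)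
  qed
  also have "\<dots> = ?f {0} * nc_sum ?f ?f ?g ?A +
    (\<Sum>j\<in>?A. nc_sum ?g ?g ?g (?A \<inter> {..<j}) * nc_sum (\<lambda>B. ?f (insert 0 B)) ?f ?g (?A \<inter> {j..}))"
    by (rule nc_sum_insert) auto
  also have "?f {0} = 0" using V1[of 0] by (simp add: nths_xs)
  also have "(\<Sum>j\<in>?A. nc_sum ?g ?g ?g (?A \<inter> {..<j}) * nc_sum (\<lambda>B. ?f (insert 0 B)) ?f ?g (?A \<inter> {j..}))
     = (\<Sum>j\<in>{1}. nc_sum ?g ?g ?g (?A \<inter> {..<j}) * nc_sum (\<lambda>B. ?f (insert 0 B)) ?f ?g (?A \<inter> {j..}))"
  proof (rule sum.mono_neutral_right)
    show "\<forall>j\<in>?A - {1}. nc_sum ?g ?g ?g (?A \<inter> {..<j}) * nc_sum (\<lambda>B. ?f (insert 0 B)) ?f ?g (?A \<inter> {j..}) = 0"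
    proof
      fix j assume j: "j \<in> ?A - {1}"
      have "nc_sum (\<lambda>B. ?f (insert 0 B)) ?f ?g (?A \<inter> {j..}) = 0"
      proof (rule nc_sum_zero)
        show "?A \<inter> {j..} \<noteq> {}" using j by auto
        fix B assume B: "B \<subseteq> ?A \<inter> {j..}"
        then have "insert 0 B \<subseteq> {..<Suc (Suc n)}" "1 \<notin> B" using j by auto
        then show "?f (insert 0 B) = 0" using V1 by (subst nths_xs) auto
      qed auto
      then show "nc_sum ?g ?g ?g (?A \<inter> {..<j}) * nc_sum (\<lambda>B. ?f (insert 0 B)) ?f ?g (?A \<inter> {j..}) = 0"
        by simp
    qed
  qed auto
  also have "\<dots> = nc_sum (\<lambda>B. ?f (insert 0 B)) ?f ?g ?A"
  proof -
    \<comment> \<open>Positions 0 and 1 are neighbours, so the gap between them is empty and has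
      weight 1.\<close>
    have "?A \<inter> {..<1} = {}" "?A \<inter> {1..} = ?A" by auto
    then show ?thesis by (simp del: lessThan_Suc)
  qed
  also have "\<dots> = nc_sum (\<lambda>B. c * R (1 + card B)) (\<lambda>B. R (card B)) (\<lambda>B. r (card B)) ?A"
  proof (rule nc_sum_cong)
    have Min: "Min ?A = 1" by (rule Min_eqI) auto
    fix B assume B: "B \<subseteq> ?A"
    then have fin: "finite B" by (rule finite_subset) simp
    have sub: "insert 0 B \<subseteq> {..<Suc (Suc n)}" "B \<subseteq> {..<Suc (Suc n)}" "0 \<notin> B" using B by auto
    show "?f (insert 0 B) = c * R (1 + card B)" if "Min ?A \<in> B"
    proof -
      have B1: "1 \<in> B" using that unfolding Min .
      have "insert 0 B - {0, 1} = B - {1}" using sub(3) by auto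
      \<comment> \<open>The block \<open>insert 0 B\<close> has two entries \<open>V\<close> and
        \<open>card (B - {1})\<close> entries \<open>S\<close>, in total
        \<open>1 + card B\<close>.\<close>
      moreover have "card B = Suc (card (B - {1}))" by (rule card.remove[OF fin B1])
      ultimately show ?thesis using V2[of "card (B - {1})"] B1
        unfolding nths_xs[OF sub(1)] by simp
    qed
    show "?f B = R (card B)" "?g B = r (card B)" if "Min ?A \<notin> B"
    proof -
      have B1: "1 \<notin> B" using that unfolding Min .
      then have "B - {0, 1} = B" using sub(3) by auto
      then show "?f B = R (card B)" "?g B = r (card B)"
        using sub(3) B1 unfolding nths_xs[OF sub(2)] R_def r_def by simp_all
    qed
  qed auto
  also have "\<dots> = c * nc_card_sum R r 1 ?A"
    unfolding nc_card_sum_def by (rule nc_sum_mult) auto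
  also have "nc_card_sum R r 1 ?A = nc_card_sum R r 1 {..<Suc n}"
    using nc_card_sum_shift[of R r 1 1 "Suc n"] by simp
  finally show ?thesis by simp
qed

section \<open>The equivalence\<close>

text \<open>For \<open>n \<ge> 2\<close> a chain from 1 to \<open>n\<close> has at least two and at
  most \<open>n\<close> points, so grouping the chains by length loses none of them.\<close>

lemma phi_par_eq_chain_sum:
  assumes "2 \<le> n"
  shows "phi_par \<phi> \<psi> Z n =
    chain_sum (\<lambda>k. two_state_cumulant \<phi> \<psi> (replicate k Z)) (\<lambda>i. \<psi> (Z ^ i)) 0 n"
proof -
  let ?w = "\<lambda>s. two_state_cumulant \<phi> \<psi> (replicate (length s) Z) * chain_weight (\<lambda>i. \<psi> (Z ^ i)) s"
  have long: "2 \<le> length s" if "s \<in> chains_to n" for s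
  proof (rule ccontr)
    assume "\<not> 2 \<le> length s"
    moreover have "s \<noteq> []" using that by (simp add: chains_to_def)
    ultimately obtain x where "s = [x]" by (cases s; cases "tl s") auto
    then show False using that assms by (simp add: chains_to_def)
  qed
  have "phi_par \<phi> \<psi> Z n = (\<Sum>k = 2..n. \<Sum>s\<in>{s \<in> chains_to n. length s = k}. ?w s)"
    unfolding phi_par_def chain_weight_def
    by (intro sum.cong) (auto simp: chains_to_def)
  also have "\<dots> = sum ?w (chains_to n)"
    by (rule sum.group) (use long length_chains_to finite_chains_to in auto)
  finally show ?thesis by (simp add: chain_sum_def)
qed

text \<open>The linear term comes from the one-point chain \<open>[1]\<close>, which
  \<open>phi_par\<close> excludes by starting at \<open>k = 2\<close>.\<close>

lemma C_par_eq:
  "Abs_fps (chain_sum (\<lambda>k. two_state_cumulant \<phi> \<psi> (replicate k Z)) (\<lambda>i. \<psi> (Z ^ i)) 0) =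
     fps_X * fps_const (two_state_cumulant \<phi> \<psi> [Z]) + C_par \<phi> \<psi> Z"
proof (rule fps_ext)
  fix n :: nat
  let ?c = "chain_sum (\<lambda>k. two_state_cumulant \<phi> \<psi> (replicate k Z)) (\<lambda>i. \<psi> (Z ^ i)) 0"
  consider "n = 0" | "n = 1" | l where "n = l + 2"
    by (metis One_nat_def add_2_eq_Suc' not0_implies_Suc)
  then show "fps_nth (Abs_fps ?c) n =
    fps_nth (fps_X * fps_const (two_state_cumulant \<phi> \<psi> [Z]) + C_par \<phi> \<psi> Z) n"
  proof cases
    case 3
    then show ?thesis
      using phi_par_eq_chain_sum[of n \<phi> \<psi> Z] by (simp add: C_par_def fps_X_power_mult_nth)
  qed (simp_all add: C_par_def fps_X_power_mult_nth chain_sum_rec[of _ _ 0 0] chain_sum_rec[of _ _ 0 "Suc 0"])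
qed

section \<open>The three statements as identities of formal power series\<close>

lemma fps_eq_divide_iff:
  fixes f g h :: "complex fps"
  assumes "fps_nth g 0 \<noteq> 0"
  shows "f = h / g \<longleftrightarrow> f * g = h"
proof -
  have "g * inverse g = 1" using inverse_mult_eq_1'[OF assms] .
  moreover have "h / g = h * inverse g" by (rule fps_divide_unit[OF assms])
  ultimately show ?thesis by (metis mult.assoc mult.commute mult.right_neutral)
qed

text \<open>Cleared of denominators, the three identities say that \<open>Q\<close>,
  \<open>num - M * D\<close> and \<open>C * E - N * z\<^sup>2 * B\<close> vanish. The first times
  \<open>N\<close> and the third times \<open>M\<close> both equal the second, and series with
  constant term 1 can be cancelled.\<close>

lemma series_identity_iff:
  fixes M N C T :: "complex fps" and a b a' b' :: complex
  defines "z \<equiv> fps_X"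
  assumes M: "M - 1 = (z * fps_const a + C) * M" and T: "T * N = C * M"
    and M0: "fps_nth M 0 = 1" and N0: "fps_nth N 0 = 1"
  shows "fps_const (b' + 1) * T = M * (fps_const b' + z * fps_const (a' - a * b') + fps_const (b - a * a') * z\<^sup>2)
            - fps_const b' - z * fps_const a' \<longleftrightarrow>
      M = ((fps_const b' + z * fps_const a') * N - fps_const b' - 1) /
        (N * (fps_const (b - a * a') * z\<^sup>2 + z * fps_const (a' - a * b') + fps_const b')
          - (fps_const b' + 1) * (1 - fps_const a * z))" (is "?s1 \<longleftrightarrow> ?s2")
    and "M = ((fps_const b' + z * fps_const a') * N - fps_const b' - 1) /
        (N * (fps_const (b - a * a') * z\<^sup>2 + z * fps_const (a' - a * b') + fps_const b')
          - (fps_const b' + 1) * (1 - fps_const a * z)) \<longleftrightarrow>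
      C = (N * z\<^sup>2 * fps_const b) / (- N * (fps_const b' + z * fps_const a') + fps_const b' + 1)"
      (is "?s2 \<longleftrightarrow> ?s3")
proof -
  define A B A' B' where "A = fps_const a" and "B = fps_const b" and "A' = fps_const a'" and "B' = fps_const b'"
  have const: "fps_const (a' - a * b') = A' - A * B'" "fps_const (b - a * a') = B - A * A'"
    "fps_const (b' + 1) = B' + 1"
    by (simp_all add: A_def B_def A'_def B'_def)
  define D where "D = N * ((B - A * A') * z\<^sup>2 + z * (A' - A * B') + B') - (B' + 1) * (1 - A * z)"
  define num where "num = (B' + z * A') * N - B' - 1"
  define E where "E = - N * (B' + z * A') + B' + 1"
  define Q where "Q = (B' + 1) * T - (M * (B' + z * (A' - A * B') + (B - A * A') * z\<^sup>2) - B' - z * A')"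
  have CM: "C * M = M - 1 - A * z * M" using M by (simp add: A_def algebra_simps)
  have "N \<noteq> 0" "M \<noteq> 0" using M0 N0 by auto
  \<comment> \<open>\<open>N\<close> has constant term 1, so \<open>D\<close> has constant term
    \<open>b' - (b' + 1)\<close>, and \<open>E\<close> below has \<open>- b' + b' + 1\<close>. Both
    quotients are thus divisions by units.\<close>
  have "fps_nth D 0 = -1" by (simp add: D_def N0 B'_def z_def)
  then have s2: "?s2 \<longleftrightarrow> M * D = num"
    unfolding const A_def[symmetric] B_def[symmetric] A'_def[symmetric] B'_def[symmetric]
      D_def[symmetric] num_def[symmetric]
    by (intro fps_eq_divide_iff) simp
  have "fps_nth E 0 = 1" by (simp add: E_def N0 B'_def z_def)
  then have s3: "?s3 \<longleftrightarrow> C * E = N * z\<^sup>2 * B"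
    unfolding const A_def[symmetric] B_def[symmetric] A'_def[symmetric] B'_def[symmetric] E_def[symmetric]
    by (intro fps_eq_divide_iff) simp
  have "Q * N = (B' + 1) * (T * N) - N * (M * (B' + z * (A' - A * B') + (B - A * A') * z\<^sup>2) - B' - z * A')"
    by (simp add: Q_def algebra_simps)
  also have "\<dots> = num - M * D"
    unfolding T CM by (simp add: D_def num_def algebra_simps)
  finally have "Q * N = num - M * D" .
  then have "Q = 0 \<longleftrightarrow> M * D = num" using \<open>N \<noteq> 0\<close> by (metis eq_iff_diff_eq_0 mult_eq_0_iff)
  moreover have "?s1 \<longleftrightarrow> Q = 0"
    unfolding const A_def[symmetric] B_def[symmetric] A'_def[symmetric] B'_def[symmetric] Q_def by simp
  ultimately show "?s1 \<longleftrightarrow> ?s2" using s2 by simp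
  have "(C * E - N * z\<^sup>2 * B) * M = (C * M) * E - N * z\<^sup>2 * B * M" by (simp add: algebra_simps)
  also have "\<dots> = num - M * D"
    unfolding CM by (simp add: D_def num_def E_def algebra_simps power2_eq_square)
  finally have "C * E - N * z\<^sup>2 * B = 0 \<longleftrightarrow> M * D = num"
    using \<open>M \<noteq> 0\<close> by (metis eq_iff_diff_eq_0 mult_eq_0_iff)
  then show "?s2 \<longleftrightarrow> ?s3" using s2 s3 by simp
qed

text \<open>The recursion is the comparison of the coefficients from index 2 on. The terms
  subtracted on the right make the first two agree by themselves: they are \<open>b' - b'\<close>
  and \<open>b' * a + (a' - a * b') - a'\<close>, both 0 like the left-hand ones.\<close>

lemma moment_recursion_iff:
  fixes f w :: "nat \<Rightarrow> complex" and a b a' b' :: complex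
  assumes "f 0 = 1" "f 1 = a" "w 0 = 0"
  shows "(\<forall>n. (b' + 1) * w (Suc n) = b' * f (n + 2) + (a' - a * b') * f (n + 1) + (b - a * a') * f n) \<longleftrightarrow>
    fps_const (b' + 1) * (fps_X * Abs_fps w) =
      Abs_fps f * (fps_const b' + fps_X * fps_const (a' - a * b') + fps_const (b - a * a') * fps_X\<^sup>2)
        - fps_const b' - fps_X * fps_const a'" (is "?l \<longleftrightarrow> ?L = ?R")
proof -
  have R: "?R = fps_const b' * Abs_fps f + fps_const (a' - a * b') * (fps_X * Abs_fps f) +
      fps_const (b - a * a') * (fps_X\<^sup>2 * Abs_fps f) - fps_const b' - fps_const a' * fps_X"
    by (simp only: algebra_simps)
  have 0: "fps_nth ?L 0 = fps_nth ?R 0" "fps_nth ?L 1 = fps_nth ?R 1"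
    unfolding R using assms by (simp_all add: fps_X_power_mult_nth algebra_simps)
  have 2: "fps_nth ?L (n + 2) = (b' + 1) * w (Suc n)"
    "fps_nth ?R (n + 2) = b' * f (n + 2) + (a' - a * b') * f (n + 1) + (b - a * a') * f n" for n
    unfolding R by (simp_all add: fps_X_power_mult_nth)
  have "?L = ?R \<longleftrightarrow> (\<forall>n. fps_nth ?L (n + 2) = fps_nth ?R (n + 2))"
  proof
    assume *: "\<forall>n. fps_nth ?L (n + 2) = fps_nth ?R (n + 2)"
    show "?L = ?R"
    proof (rule fps_ext)
      fix n :: nat
      consider "n = 0" | "n = 1" | l where "n = l + 2"
        by (metis One_nat_def add_2_eq_Suc' not0_implies_Suc)
      then show "fps_nth ?L n = fps_nth ?R n" using 0 * by cases auto
    qed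
  qed simp
  then show ?thesis unfolding 2 by blast
qed

text \<open>With i entries \<open>V\<close> and all others \<open>S\<close>, the two surviving words
  have coefficients \<beta>^i for \<open>X\<close> and (-\<alpha>)^i for \<open>Y\<close>. The
  hypothesis \<open>ratio\<close> then settles i = 1 and i = 2.\<close>

lemma linear_regression_cumulants:
  assumes lin: "complex_linear \<phi>" "complex_linear \<psi>" and free: "c_free_elements \<phi> \<psi> X Y"
    and ratio: "\<And>k. k \<ge> 1 \<Longrightarrow> \<beta> * two_state_cumulant \<phi> \<psi> (replicate k X) =
          \<alpha> * two_state_cumulant \<phi> \<psi> (replicate k Y)"
    and "\<alpha> + \<beta> = 1"
  defines "V \<equiv> \<beta> *\<^sub>C X - \<alpha> *\<^sub>C Y" and "S \<equiv> X + Y"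
  shows "two_state_cumulant \<phi> \<psi> (V # replicate k S) = 0"
    and "two_state_cumulant \<phi> \<psi> (V # V # replicate k S) =
      \<alpha> * \<beta> * two_state_cumulant \<phi> \<psi> (replicate (k + 2) S)"
proof -
  let ?g = "\<lambda>(c, d). c *\<^sub>C X + d *\<^sub>C Y"
  let ?T = "two_state_cumulant \<phi> \<psi>"
  have V: "V = ?g (\<beta>, - \<alpha>)" by (simp add: V_def scaleC_minus_left)
  have S: "S = ?g (1, 1)" by (simp add: S_def scaleC_one)
  have comb: "?T (map ?g l) = prod_list (map fst l) * ?T (replicate (length l) X) +
      prod_list (map snd l) * ?T (replicate (length l) Y)" if "l \<noteq> []" for l
    using two_state_cumulant_combinations[OF lin free, of "[]" l] that by simp
  have 1: "V # replicate k S = map ?g ((\<beta>, - \<alpha>) # replicate k (1, 1))"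
    and 2: "V # V # replicate k S = map ?g ((\<beta>, - \<alpha>) # (\<beta>, - \<alpha>) # replicate k (1, 1))"
    and 3: "replicate (k + 2) S = map ?g (replicate (k + 2) (1, 1))"
    unfolding V S by simp_all
  show "?T (V # replicate k S) = 0"
    unfolding 1 by (subst comb) (use ratio[of "Suc k"] in simp_all)
  define x y where "x = ?T (replicate (k + 2) X)" and "y = ?T (replicate (k + 2) Y)"
  have xy: "\<beta> * x = \<alpha> * y" using ratio[of "k + 2"] by (simp add: x_def y_def)
  have "?T (V # V # replicate k S) = \<beta> * (\<beta> * x) + \<alpha> * (\<alpha> * y)"
    unfolding 2 by (subst comb) (simp_all add: x_def y_def mult.assoc)
  \<comment> \<open>\<open>xy\<close> is used in both directions: \<beta>(\<beta>x) =
    \<alpha>\<beta>y and \<alpha>(\<alpha>y) = \<alpha>\<beta>x.\<close>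
  also have "\<dots> = \<alpha> * \<beta> * (x + y)"
    using xy by (metis (no_types, lifting) add.commute distrib_left mult.assoc mult.left_commute)
  also have "x + y = ?T (replicate (k + 2) S)"
    unfolding 3 by (subst comb) (simp_all add: x_def y_def)
  finally show "?T (V # V # replicate k S) = \<alpha> * \<beta> * ?T (replicate (k + 2) S)" .
qed

theorem theorem4p6:
  fixes \<phi> \<psi> :: "'a::complex_star_algebra \<Rightarrow> complex"
    and X Y S :: 'a
    and a b a' b' \<alpha> \<beta> :: real
    and \<mu> \<nu> :: "real measure"
  assumes "state \<phi>" and "state \<psi>" and "tracial \<psi>"
    and "b > 0" and "b' > - 1"
    and "\<alpha> > 0" and "\<beta> > 0" and "\<alpha> + \<beta> = 1"
    and "self_adjoint X" and "self_adjoint Y"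
    and "\<exists>\<rho>. has_law \<phi> X \<rho>" and "\<exists>\<rho>. has_law \<psi> X \<rho>"
    and "\<exists>\<rho>. has_law \<phi> Y \<rho>" and "\<exists>\<rho>. has_law \<psi> Y \<rho>"
    and "c_free_elements \<phi> \<psi> X Y"
    and "\<phi> (X + Y) = complex_of_real a"
    and "\<phi> ((X + Y)\<^sup>2) = complex_of_real (b + a\<^sup>2)"
    and "\<And>k. k \<ge> 1 \<Longrightarrow>
          complex_of_real \<beta> * two_state_cumulant \<phi> \<psi> (replicate k X) =
          complex_of_real \<alpha> * two_state_cumulant \<phi> \<psi> (replicate k Y)"
    and "S = X + Y"
    and "has_law \<phi> S \<mu>" and "has_law \<psi> S \<nu>"
  defines "M\<^sub>\<mu> \<equiv> moment_series \<phi> S"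
    and "M\<^sub>\<nu> \<equiv> moment_series \<psi> S"
    and "z \<equiv> fps_X :: complex fps"
  defines "statement1 \<equiv>
      (\<forall>n. \<phi> ((complex_of_real \<beta> *\<^sub>C X - complex_of_real \<alpha> *\<^sub>C Y)\<^sup>2 * S ^ n) =
        complex_of_real (\<alpha> * \<beta> / (b' + 1)) *
        \<phi> ((complex_of_real b' *\<^sub>C S\<^sup>2 + complex_of_real (a' - a * b') *\<^sub>C S
             + complex_of_real (b - a * a') *\<^sub>C 1) * S ^ n))"
    and "statement2 \<equiv>
      M\<^sub>\<mu> = ((fps_real b' + z * fps_real a') * M\<^sub>\<nu> - fps_real b' - 1) /
        (M\<^sub>\<nu> * (fps_real (b - a * a') * z\<^sup>2 + z * fps_real (a' - a * b') + fps_real b')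
          - (fps_real b' + 1) * (1 - fps_real a * z))"
    and "statement3 \<equiv>
      C_par \<phi> \<psi> S = (M\<^sub>\<nu> * z\<^sup>2 * fps_real b) /
        (- M\<^sub>\<nu> * (fps_real b' + z * fps_real a') + fps_real b' + 1)"
  shows "(statement1 \<longleftrightarrow> statement2) \<and> (statement2 \<longleftrightarrow> statement3)"
proof -
  have lin: "complex_linear \<phi>" "complex_linear \<psi>"
    using assms(1,2) by (simp_all add: state_complex_linear)
  have unit: "\<phi> 1 = 1" "\<psi> 1 = 1" using assms(1,2) by (simp_all add: state_def)
  define R where "R k = two_state_cumulant \<phi> \<psi> (replicate k S)" for k
  define r where "r k = free_cumulant \<psi> (replicate k S)" for k
  define m where "m i = \<psi> (S ^ i)" for i
  have R_fold: "(\<lambda>k. two_state_cumulant \<phi> \<psi> (replicate k S)) = R" by (simp add: R_def fun_eq_iff)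
  have r_fold: "(\<lambda>k. free_cumulant \<psi> (replicate k S)) = r" by (simp add: r_def fun_eq_iff)
  have m_fold: "(\<lambda>i. \<psi> (S ^ i)) = m" by (simp add: m_def fun_eq_iff)
  have phi: "\<phi> (S ^ n) = nc_card_sum R r 0 {..<n}" for n
    using moment_eq_nc_card_sum[of \<phi> S n \<psi>] unit by (simp add: R_fold r_fold)
  have psi: "m n = nc_card_sum r r 0 {..<n}" for n
    using free_moment_eq_nc_card_sum[of \<psi> S n] unit by (simp add: r_fold m_def)
  have M: "M\<^sub>\<mu> = nc_fps R r" unfolding M\<^sub>\<mu>_def moment_series_def nc_fps_def phi ..
  have N: "M\<^sub>\<nu> = nc_fps r r" "M\<^sub>\<nu> = Abs_fps m"
    unfolding M\<^sub>\<nu>_def moment_series_def nc_fps_def m_fold using psi by (simp_all add: fun_eq_iff fps_eq_iff)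
  have phiS: "\<phi> S = complex_of_real a" using assms by simp
  have R1: "R 1 = complex_of_real a"
    using phi[of 1] nc_card_sum_Suc[of R r 0 0] by (simp add: phiS)
  have chain0: "Abs_fps (chain_sum R m 0) = z * fps_real a + C_par \<phi> \<psi> S"
    using C_par_eq[of \<phi> \<psi> S] R1 by (simp add: R_fold m_fold z_def R_def)
  \<comment> \<open>The offset 1 fuses the two entries \<open>V\<close> into one point; the extra
    factor \<open>z\<close> accounts for the point lost in this way.\<close>
  define T where "T = z * nc_fps_shifted R r 1"
  have shifted: "nc_fps_shifted R r k = Abs_fps (chain_sum R m k) * M\<^sub>\<mu>" for k
    using nc_fps_shifted_eq[of m r R k] N M by simp
  have M_eq: "M\<^sub>\<mu> - 1 = (fps_X * fps_real a + C_par \<phi> \<psi> S) * M\<^sub>\<mu>"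
    using shifted[of 0] chain0 by (simp add: nc_fps_shifted_0 M z_def)
  \<comment> \<open>At offset 0, \<open>chain_fps_rec\<close> separates the one-point chain, which
    is the term with \<open>a\<close> in \<open>chain0\<close>. The factor M_nu appearing here is
    the gap that \<open>T\<close> lacks.\<close>
  have C: "C_par \<phi> \<psi> S = z * (M\<^sub>\<nu> * Abs_fps (chain_sum R m 1))"
    using chain_fps_rec[of R m 0] chain0 R1 N(2) by (simp add: z_def)
  have T: "T * M\<^sub>\<nu> = C_par \<phi> \<psi> S * M\<^sub>\<mu>"
    unfolding T_def shifted C by (simp add: algebra_simps)
  have M0: "fps_nth M\<^sub>\<mu> 0 = 1" and N0: "fps_nth M\<^sub>\<nu> 0 = 1"
    by (simp_all add: M\<^sub>\<mu>_def M\<^sub>\<nu>_def moment_series_def unit)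
  define V where "V = complex_of_real \<beta> *\<^sub>C X - complex_of_real \<alpha> *\<^sub>C Y"
  have ab: "complex_of_real \<alpha> + complex_of_real \<beta> = 1"
    using \<open>\<alpha> + \<beta> = 1\<close> by (metis of_real_1 of_real_add)
  have lhs: "\<phi> (V\<^sup>2 * S ^ n) = complex_of_real \<alpha> * complex_of_real \<beta> * nc_card_sum R r 1 {..<Suc n}" for n
  proof -
    note cumulants = linear_regression_cumulants[OF lin assms(15,18) ab,
        folded V_def \<open>S = X + Y\<close>]
    show ?thesis
      using moment_first_two_linked[where V=V and S=S and \<phi>=\<phi> and \<psi>=\<psi>, OF cumulants]
      unfolding R_fold r_fold .
  qed
  have rhs: "\<phi> ((complex_of_real b' *\<^sub>C S\<^sup>2 + complex_of_real (a' - a * b') *\<^sub>C S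
             + complex_of_real (b - a * a') *\<^sub>C 1) * S ^ n) =
      complex_of_real b' * \<phi> (S ^ (n + 2)) + complex_of_real (a' - a * b') * \<phi> (S ^ (n + 1)) +
        complex_of_real (b - a * a') * \<phi> (S ^ n)" for n
    by (simp add: distrib_right mult_scaleC_left complex_linear_add[OF lin(1)]
        complex_linear_scale[OF lin(1)] power2_eq_square mult.assoc)
  \<comment> \<open>The value 0 at index 0 lets \<open>T\<close> start with the square of
    \<open>z\<close>, so that its coefficient at \<open>n + 2\<close> is
    \<open>w (Suc n)\<close>.\<close>
  define w where "w n = (if n = 0 then 0 else nc_card_sum R r 1 {..<n})" for n
  have T_w: "T = fps_X * Abs_fps w"
    by (simp add: T_def z_def nc_fps_shifted_def w_def fps_eq_iff)
  have b'1: "complex_of_real b' + 1 \<noteq> 0"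
    using \<open>b' > - 1\<close> by (simp add: complex_eq_iff)
  have "statement1 \<longleftrightarrow> (\<forall>n. (complex_of_real b' + 1) * w (Suc n) =
      complex_of_real b' * \<phi> (S ^ (n + 2)) +
      (complex_of_real a' - complex_of_real a * complex_of_real b') * \<phi> (S ^ (n + 1)) +
      (complex_of_real b - complex_of_real a * complex_of_real a') * \<phi> (S ^ n))"
  proof -
    \<comment> \<open>\<alpha> and \<beta> are positive, so their product, present on both sides of
      the first statement, cancels.\<close>
    have "p * v = complex_of_real (\<alpha> * \<beta> / (b' + 1)) * u \<longleftrightarrow> (complex_of_real b' + 1) * v = u"
      if p: "p = complex_of_real \<alpha> * complex_of_real \<beta>" for p u v
    proof -
      have "p \<noteq> 0" using p \<open>\<alpha> > 0\<close> \<open>\<beta> > 0\<close> by simp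
      have eq: "complex_of_real (\<alpha> * \<beta> / (b' + 1)) * u = p * (u / (complex_of_real b' + 1))"
        by (simp add: p)
      have "p * v = complex_of_real (\<alpha> * \<beta> / (b' + 1)) * u \<longleftrightarrow> v = u / (complex_of_real b' + 1)"
        unfolding eq using \<open>p \<noteq> 0\<close> by (simp only: mult_cancel_left) simp
      then show ?thesis by (simp only: nonzero_eq_divide_eq[OF b'1] mult.commute)
    qed
    then show ?thesis
      unfolding statement1_def V_def[symmetric] lhs rhs by (simp add: w_def del: lessThan_Suc)
  qed
  also have "\<dots> \<longleftrightarrow> fps_const (complex_of_real b' + 1) * T =
      M\<^sub>\<mu> * (fps_real b' + fps_X * fps_const (complex_of_real a' - complex_of_real a * complex_of_real b')
        + fps_const (complex_of_real b - complex_of_real a * complex_of_real a') * fps_X\<^sup>2)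
        - fps_real b' - fps_X * fps_real a'"
    unfolding T_w M\<^sub>\<mu>_def moment_series_def
    by (rule moment_recursion_iff) (simp_all add: unit phiS w_def)
  also have "\<dots> \<longleftrightarrow> statement2"
    unfolding statement2_def z_def of_real_diff of_real_mult
    by (rule series_identity_iff(1)[OF M_eq T M0 N0])
  finally have "statement1 \<longleftrightarrow> statement2" .
  moreover have "statement2 \<longleftrightarrow> statement3"
    unfolding statement2_def statement3_def z_def of_real_diff of_real_mult
    by (rule series_identity_iff(2)[OF M_eq T M0 N0])
  ultimately show ?thesis by blast
qed

end
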